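(* Let $H$ be a Hopf algebra over $\mathbb{C}$ with bijective antipode. Assume that $A$ is an $H$-bicomodule algebra which is both a left Galois object and a right Galois object over $H$. Let $A*_HA$ be the $H$-braided join algebra of $A$, and let $\Delta_{A*_HA}\colon A*_HA\to (A*_HA)\otimes H$ be the diagonal right coaction. Then the coaction $\Delta_{A*_HA}$ is principal. Furthermore, the coaction-invariant subalgebra $(A*_HA)^{\mathrm{co}H}$ is isomorphic (as an algebra) to the unreduced suspension of $H$, $$\Sigma H:=\{g\in C([0,1])\otimes H\;|\; g(0),g(1)\in\mathbb{C}\}.$$
   Context: All algebras are unital over $\mathbb{C}$, all unadorned tensor products are algebraic tensor products over $\mathbb{C}$, $C([0,1])$ is the algebra of continuous complex-valued functions on $[0,1]$, and $\mathrm{ev}_r(f)=f(r)$. For $g\in C([0,1])\otimes H$, $g(r)=(\mathrm{ev}_r\otimes\mathrm{id})(g)$, and $\mathbb{C}$ is regarded as $\mathbb{C}1\subseteq H$. Sweedler notation: $\Delta(h)=h_{(1)}\otimes h_{(2)}$; for a right coaction $\Delta_P(p)=p_{(0)}\otimes p_{(1)}\in P\otimes H$; for a left coaction ${}_Q\Delta(q)=q_{(-1)}\otimes q_{(0)}\in H\otimes Q$. A right (left) $H$-comodule algebra is an algebra with a right (left) $H$-coaction that is a unital algebra homomorphism. An $H$-bicomodule algebra $A$ is an algebra that is a left and a right $H$-comodule algebra with commuting coactions: $({}_A\Delta\otimes\mathrm{id})\circ\Delta_A=(\mathrm{id}\otimes\Delta_A)\circ{}_A\Delta$. Coaction-invariant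 subalgebras: $P^{\mathrm{co}H}=\{p\,|\,\Delta_P(p)=p\otimes1\}$ and ${}^{\mathrm{co}H}Q=\{q\,|\,{}_Q\Delta(q)=1\otimes q\}$. $A$ is a right Galois object over $H$ if $A^{\mathrm{co}H}=\mathbb{C}$ and $\mathrm{can}_A\colon A\otimes A\to A\otimes H$, $p\otimes p'\mapsto pp'_{(0)}\otimes p'_{(1)}$, is bijective. $A$ is a left Galois object over $H$ if ${}^{\mathrm{co}H}A=\mathbb{C}$ and ${}_A\mathrm{can}\colon A\otimes A\to H\otimes A$, $q\otimes q'\mapsto q_{(-1)}\otimes q_{(0)}q'$, is bijective. For a left Galois object $A$, the left Hopf-Galois braided algebra $A\,\underline{\otimes}\,A$ is the vector space $A\otimes A$ with the multiplication pulled back along ${}_A\mathrm{can}$ from the tensor product algebra $H\otimes A$, i.e. $x\bullet y:={}_A\mathrm{can}^{-1}\big({}_A\mathrm{can}(x)\,{}_A\mathrm{can}(y)\big)$. The $H$-braided join algebra of $A$ is the unital algebra $$A*_HA:=\{x\in C([0,1])\otimes A\underline{\otimes}A\;|\;(\mathrm{ev}_0\otimes\mathrm{id})(x)\in\mathbb{C}\otimes A\text{ and }(\mathrm{ev}_1\otimes\mathrm{id})(x)\in A\otimes\mathbb{C}\}.$$ The diagonal coaction $\Delta_{A*_HA}$ is the restriction to $A*_HA$ of $f\otimes a\otimes b\mapsto f\otimes a_{(0)}\otimes b_{(0)}\otimes a_{(1)}b_{(1)}$; it makes $A*_HA$ a right $H$-comodule algebra. Let $H$ have bijective antipode $S$ and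 let $P$ be a right $H$-comodule algebra. A strong connection on $P$ is a unital linear map $\ell\colon H\to P\otimes P$ such that: (1) $(\mathrm{id}\otimes\Delta_P)\circ\ell=(\ell\otimes\mathrm{id})\circ\Delta$ and $(\Delta_P^L\otimes\mathrm{id})\circ\ell=(\mathrm{id}\otimes\ell)\circ\Delta$, where $\Delta_P^L:=(S^{-1}\otimes\mathrm{id})\circ\mathrm{flip}\circ\Delta_P$; (2) $\widetilde{\mathrm{can}}\circ\ell=1\otimes\mathrm{id}$, where $\widetilde{\mathrm{can}}\colon P\otimes P\to P\otimes H$, $p\otimes q\mapsto(p\otimes1)\Delta_P(q)$. The coaction $\Delta_P$ (or the comodule algebra $P$) is called principal if $P$ admits a strong connection. *)

theory Defs
  imports Complex_Main "HOL-Library.Poly_Mapping"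
begin

section \<open>Complex vector spaces and algebras\<close>

class complex_vector = ab_group_add +
  fixes scaleC :: "complex \<Rightarrow> 'a \<Rightarrow> 'a"  (infixr \<open>*\<^sub>C\<close> 75)
  assumes scaleC_add_right: "c *\<^sub>C (x + y) = c *\<^sub>C x + c *\<^sub>C y"
    and scaleC_add_left: "(c + d) *\<^sub>C x = c *\<^sub>C x + d *\<^sub>C x"
    and scaleC_scaleC [simp]: "c *\<^sub>C (d *\<^sub>C x) = (c * d) *\<^sub>C x"
    and scaleC_one [simp]: "1 *\<^sub>C x = x"

class complex_algebra_1 = complex_vector + ring_1 +
  assumes mult_scaleC_left [simp]: "(c *\<^sub>C x) * y = c *\<^sub>C (x * y)"
    and mult_scaleC_right [simp]: "x * (c *\<^sub>C y) = c *\<^sub>C (x * y)"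

global_interpretation cv: vector_space "scaleC :: complex \<Rightarrow> 'a \<Rightarrow> 'a::complex_vector"
  by unfold_locales (simp_all add: scaleC_add_right scaleC_add_left)

abbreviation clinear :: "('a::complex_vector \<Rightarrow> 'b::complex_vector) \<Rightarrow> bool" where
  "clinear \<equiv> Vector_Spaces.linear scaleC scaleC"

definition cbilinear :: "('a::complex_vector \<Rightarrow> 'b::complex_vector \<Rightarrow> 'c::complex_vector) \<Rightarrow> bool" where
  "cbilinear f \<longleftrightarrow> (\<forall>a. clinear (f a)) \<and> (\<forall>b. clinear (\<lambda>a. f a b))"

lemma clinear_iff:
  "clinear f \<longleftrightarrow> (\<forall>x y. f (x + y) = f x + f y) \<and> (\<forall>c x. f (c *\<^sub>C x) = c *\<^sub>C f x)"
  by (simp add: Vector_Spaces.linear_iff cv.vector_space_axioms)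

lemma clinear_zero: "clinear f \<Longrightarrow> f 0 = 0"
  unfolding clinear_iff by (metis add_cancel_right_right)

lemma clinear_diff: "clinear f \<Longrightarrow> f (x - y) = f x - f y"
  unfolding clinear_iff by (metis add_diff_cancel diff_add_cancel)

instantiation complex :: complex_algebra_1
begin
definition scaleC_complex :: "complex \<Rightarrow> complex \<Rightarrow> complex" where
  "scaleC_complex c z = c * z"
instance by standard (simp_all add: scaleC_complex_def algebra_simps)
end

instantiation poly_mapping :: (type, complex_vector) complex_vector
begin
lift_definition scaleC_poly_mapping :: "complex \<Rightarrow> ('a \<Rightarrow>\<^sub>0 'b) \<Rightarrow> 'a \<Rightarrow>\<^sub>0 'b"
  is "\<lambda>c f k. c *\<^sub>C f k"
  by (erule finite_subset[rotated]) auto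
instance
  by standard (transfer, simp add: fun_eq_iff scaleC_add_right scaleC_add_left)+
end

text \<open>The copy of \<^term>\<open>UNIV :: complex set\<close> inside a unital algebra.\<close>

definition scalars :: "'a::complex_algebra_1 set" where
  "scalars = range (\<lambda>c. c *\<^sub>C 1)"


section \<open>The algebraic tensor product\<close>

text \<open>Finitely supported functions on pairs form the free vector space on the set of pairs; the
  tensor product is its quotient by the span of the bilinearity relations.\<close>

definition tensor_null :: "('a::complex_vector \<times> 'b::complex_vector \<Rightarrow>\<^sub>0 complex) set" where
  "tensor_null = cv.span (
     {Poly_Mapping.single (a + a', b) 1 - (Poly_Mapping.single (a, b) 1 + Poly_Mapping.single (a', b) 1) |a a' b. True} \<union>
     {Poly_Mapping.single (a, b + b') 1 - (Poly_Mapping.single (a, b) 1 + Poly_Mapping.single (a, b') 1) |a b b'. True} \<union>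
     {Poly_Mapping.single (c *\<^sub>C a, b) 1 - c *\<^sub>C Poly_Mapping.single (a, b) 1 |c a b. True} \<union>
     {Poly_Mapping.single (a, c *\<^sub>C b) 1 - c *\<^sub>C Poly_Mapping.single (a, b) 1 |c a b. True})"

lemma subspace_tensor_null: "cv.subspace tensor_null"
  unfolding tensor_null_def by (rule cv.subspace_span)

definition tensor_rel where
  "tensor_rel x y \<longleftrightarrow> x - y \<in> tensor_null"

lemma tensor_rel_refl [simp]: "tensor_rel x x"
  by (simp add: tensor_rel_def cv.subspace_0[OF subspace_tensor_null])

lemma equivp_tensor_rel:
  "equivp (tensor_rel :: ('c::complex_vector \<times> 'd::complex_vector \<Rightarrow>\<^sub>0 complex) \<Rightarrow> _)" (is "equivp ?r")
proof (rule equivpI)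
  show "reflp ?r" by (simp add: reflp_def)
  show "symp ?r"
    unfolding symp_def tensor_rel_def
    using cv.subspace_neg[OF subspace_tensor_null] by (metis minus_diff_eq)
  show "transp ?r"
    unfolding transp_def tensor_rel_def
  proof (intro allI impI)
    fix x y z :: "'c \<times> 'd \<Rightarrow>\<^sub>0 complex"
    assume "x - y \<in> tensor_null" "y - z \<in> tensor_null"
    from cv.subspace_add[OF subspace_tensor_null this] show "x - z \<in> tensor_null" by simp
  qed
qed

quotient_type (overloaded) ('a, 'b) tensor =
  "('a::complex_vector \<times> 'b::complex_vector \<Rightarrow>\<^sub>0 complex)" / tensor_rel
  by (rule equivp_tensor_rel)

type_notation tensor (infixr \<open>\<otimes>\<close> 72)

instantiation tensor :: (complex_vector, complex_vector) complex_vector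
begin
lift_definition zero_tensor :: "('a, 'b) tensor" is 0 .
lift_definition plus_tensor :: "('a, 'b) tensor \<Rightarrow> ('a, 'b) tensor \<Rightarrow> ('a, 'b) tensor" is "(+)"
proof -
  fix a b c d :: "'a \<times> 'b \<Rightarrow>\<^sub>0 complex"
  assume "tensor_rel a b" "tensor_rel c d"
  hence "(a - b) + (c - d) \<in> tensor_null"
    unfolding tensor_rel_def by (rule cv.subspace_add[OF subspace_tensor_null])
  moreover have "(a - b) + (c - d) = (a + c) - (b + d)" by simp
  ultimately show "tensor_rel (a + c) (b + d)"
    unfolding tensor_rel_def by (simp only:)
qed
lift_definition minus_tensor :: "('a, 'b) tensor \<Rightarrow> ('a, 'b) tensor \<Rightarrow> ('a, 'b) tensor" is "(-)"
proof -
  fix a b c d :: "'a \<times> 'b \<Rightarrow>\<^sub>0 complex"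
  assume "tensor_rel a b" "tensor_rel c d"
  hence "(a - b) - (c - d) \<in> tensor_null"
    unfolding tensor_rel_def by (rule cv.subspace_diff[OF subspace_tensor_null])
  moreover have "(a - b) - (c - d) = (a - c) - (b - d)" by simp
  ultimately show "tensor_rel (a - c) (b - d)"
    unfolding tensor_rel_def by (simp only:)
qed
lift_definition uminus_tensor :: "('a, 'b) tensor \<Rightarrow> ('a, 'b) tensor" is uminus
proof -
  fix a b :: "'a \<times> 'b \<Rightarrow>\<^sub>0 complex"
  assume "tensor_rel a b"
  hence "- (a - b) \<in> tensor_null"
    unfolding tensor_rel_def by (rule cv.subspace_neg[OF subspace_tensor_null])
  moreover have "- (a - b) = (- a) - (- b)" by simp
  ultimately show "tensor_rel (- a) (- b)"
    unfolding tensor_rel_def by (simp only:)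
qed
lift_definition scaleC_tensor :: "complex \<Rightarrow> ('a, 'b) tensor \<Rightarrow> ('a, 'b) tensor" is scaleC
proof -
  fix c and a b :: "'a \<times> 'b \<Rightarrow>\<^sub>0 complex"
  assume "tensor_rel a b"
  hence "c *\<^sub>C (a - b) \<in> tensor_null"
    unfolding tensor_rel_def by (rule cv.subspace_scale[OF subspace_tensor_null])
  thus "tensor_rel (c *\<^sub>C a) (c *\<^sub>C b)"
    unfolding tensor_rel_def by (simp only: cv.scale_right_diff_distrib)
qed
instance
  by standard (transfer; simp add: algebra_simps scaleC_add_right scaleC_add_left)+
end

lift_definition tensor :: "'a::complex_vector \<Rightarrow> 'b::complex_vector \<Rightarrow> 'a \<otimes> 'b" (infixr \<open>\<otimes>\<close> 72)
  is "\<lambda>a b. Poly_Mapping.single (a, b) 1" .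

lemma tensor_abs_cases: obtains p where "x = abs_tensor p"
  using Quotient3_abs_rep[OF Quotient3_tensor, of x] by metis

lemma cbilinear_tensor: "cbilinear ((\<otimes>) :: 'a::complex_vector \<Rightarrow> 'b::complex_vector \<Rightarrow> _)"
proof -
  have "(a + a') \<otimes> b = a \<otimes> b + a' \<otimes> b" for a a' :: 'a and b :: 'b
    unfolding tensor.abs_eq plus_tensor.abs_eq scaleC_tensor.abs_eq tensor.abs_eq_iff
      tensor_rel_def tensor_null_def
    by (rule cv.span_base, blast)
  moreover have "a \<otimes> (b + b') = a \<otimes> b + a \<otimes> b'" for a :: 'a and b b' :: 'b
    unfolding tensor.abs_eq plus_tensor.abs_eq scaleC_tensor.abs_eq tensor.abs_eq_iff
      tensor_rel_def tensor_null_def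
    by (rule cv.span_base, blast)
  moreover have "(c *\<^sub>C a) \<otimes> b = c *\<^sub>C (a \<otimes> b)" for c and a :: 'a and b :: 'b
    unfolding tensor.abs_eq plus_tensor.abs_eq scaleC_tensor.abs_eq tensor.abs_eq_iff
      tensor_rel_def tensor_null_def
    by (rule cv.span_base, blast)
  moreover have "a \<otimes> (c *\<^sub>C b) = c *\<^sub>C (a \<otimes> b)" for c and a :: 'a and b :: 'b
    unfolding tensor.abs_eq plus_tensor.abs_eq scaleC_tensor.abs_eq tensor.abs_eq_iff
      tensor_rel_def tensor_null_def
    by (rule cv.span_base, blast)
  ultimately show ?thesis
    by (simp add: cbilinear_def clinear_iff)
qed

text \<open>The linear map induced by a bilinear map (universal property). It is unspecified if
  \<^term>\<open>f\<close> is not bilinear.\<close>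

definition tensor_lift ::
  "('a::complex_vector \<Rightarrow> 'b::complex_vector \<Rightarrow> 'c::complex_vector) \<Rightarrow> 'a \<otimes> 'b \<Rightarrow> 'c" where
  "tensor_lift f = (THE g. clinear g \<and> (\<forall>a b. g (a \<otimes> b) = f a b))"

lemma span_tensors: "cv.span {a \<otimes> b |a b. True} = (UNIV :: ('a::complex_vector \<otimes> 'b::complex_vector) set)"
proof -
  have "abs_tensor p \<in> cv.span {a \<otimes> b |(a::'a) (b::'b). True}" for p
  proof (induction p rule: update_induct)
    case const
    show ?case by (metis zero_tensor.abs_eq cv.span_zero)
  next
    case (update p k v)
    have "Poly_Mapping.update k v p = p + v *\<^sub>C Poly_Mapping.single k 1"
      using update(1)
      by (intro poly_mapping_eqI)
        (auto simp: lookup_update lookup_add scaleC_poly_mapping.rep_eq lookup_single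
          scaleC_complex_def in_keys_iff)
    hence "abs_tensor (Poly_Mapping.update k v p) = abs_tensor p + v *\<^sub>C (fst k \<otimes> snd k)"
      by (simp add: plus_tensor.abs_eq scaleC_tensor.abs_eq tensor.abs_eq)
    moreover have "v *\<^sub>C (fst k \<otimes> snd k) \<in> cv.span {a \<otimes> b |(a::'a) (b::'b). True}"
      by (rule cv.span_scale, rule cv.span_base) blast
    ultimately show ?case using update by (simp add: cv.span_add)
  qed
  hence "x \<in> cv.span {a \<otimes> b |(a::'a) (b::'b). True}" for x
    using tensor_abs_cases[of x] by metis
  thus ?thesis by blast
qed

lemma tensor_ext:
  fixes f g :: "'a::complex_vector \<otimes> 'b::complex_vector \<Rightarrow> 'c::complex_vector"
  assumes "clinear f" "clinear g" "\<And>a b. f (a \<otimes> b) = g (a \<otimes> b)"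
  shows "f = g"
proof
  fix x :: "'a \<otimes> 'b"
  have "x \<in> cv.span {a \<otimes> b |(a::'a) (b::'b). True}" by (subst span_tensors) simp
  thus "f x = g x"
  proof (induction rule: cv.span_induct_alt)
    case base
    show ?case using assms(1,2) by (simp add: clinear_zero)
  next
    case (step c x y)
    thus ?case using assms by (auto simp: clinear_iff)
  qed
qed

lemma tensor_lift_exists:
  fixes f :: "'a::complex_vector \<Rightarrow> 'b::complex_vector \<Rightarrow> 'c::complex_vector"
  assumes f: "cbilinear f"
  shows "\<exists>g. clinear g \<and> (\<forall>a b. g (a \<otimes> b) = f a b)"
proof -
  define F where "F p = (\<Sum>k\<in>Poly_Mapping.keys p. Poly_Mapping.lookup p k *\<^sub>C f (fst k) (snd k))" for p
  have F_eq: "F p = (\<Sum>k\<in>K. Poly_Mapping.lookup p k *\<^sub>C f (fst k) (snd k))"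
    if "finite K" "Poly_Mapping.keys p \<subseteq> K" for K p
    unfolding F_def using that
    by (intro sum.mono_neutral_left) (auto simp: in_keys_iff)
  have F_add: "F (p + q) = F p + F q" for p q
  proof -
    have "Poly_Mapping.keys (p + q) \<subseteq> Poly_Mapping.keys p \<union> Poly_Mapping.keys q"
      by (rule Poly_Mapping.keys_add)
    thus ?thesis
      by (simp add: F_eq[of "Poly_Mapping.keys p \<union> Poly_Mapping.keys q"] lookup_add scaleC_add_left sum.distrib)
  qed
  have F_scale: "F (c *\<^sub>C p) = c *\<^sub>C F p" for c p
  proof -
    have "Poly_Mapping.keys (c *\<^sub>C p) \<subseteq> Poly_Mapping.keys p"
      by (auto simp: in_keys_iff scaleC_poly_mapping.rep_eq)
    thus ?thesis
      by (simp add: F_eq[of "Poly_Mapping.keys p"] scaleC_poly_mapping.rep_eq cv.scale_sum_right scaleC_complex_def)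
  qed
  have F_single: "F (Poly_Mapping.single (a, b) 1) = f a b" for a b
    by (simp add: F_def)
  have F_lin: "clinear F" by (simp add: clinear_iff F_add F_scale)
  have F_diff: "F (p - q) = F p - F q" for p q
    using F_lin by (rule clinear_diff)
  have F_null: "F p = 0" if "p \<in> tensor_null" for p
    using that unfolding tensor_null_def
  proof (induction rule: cv.span_induct_alt)
    case base
    show ?case by (simp add: F_def)
  next
    case (step c x y)
    have "F x = 0"
      using step(1) f
      by (auto simp: F_diff F_add F_scale F_single cbilinear_def clinear_iff)
    thus ?case using step by (simp add: F_add F_scale)
  qed
  define g where "g t = F (rep_tensor t)" for t
  have g_abs: "g (abs_tensor p) = F p" for p
  proof -
    have "tensor_rel (rep_tensor (abs_tensor p)) p"
      using Quotient3_rep_abs[OF Quotient3_tensor] by simp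
    thus ?thesis
      using F_null[of "rep_tensor (abs_tensor p) - p"] by (simp add: F_diff tensor_rel_def g_def)
  qed
  have "g (x + y) = g x + g y" for x y
    by (cases x rule: tensor_abs_cases; cases y rule: tensor_abs_cases)
      (simp add: plus_tensor.abs_eq g_abs F_add)
  moreover have "g (c *\<^sub>C x) = c *\<^sub>C g x" for c x
    by (cases x rule: tensor_abs_cases) (simp add: scaleC_tensor.abs_eq g_abs F_scale)
  ultimately have "clinear g" by (simp add: clinear_iff)
  thus ?thesis by (intro exI[of _ g]) (simp add: tensor.abs_eq g_abs F_single)
qed

lemma
  assumes "cbilinear f"
  shows clinear_tensor_lift: "clinear (tensor_lift f)"
    and tensor_lift_tensor: "tensor_lift f (a \<otimes> b) = f a b"
proof -
  have "\<exists>!g. clinear g \<and> (\<forall>a b. g (a \<otimes> b) = f a b)"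
    using tensor_lift_exists[OF assms] by (auto intro: tensor_ext)
  hence "clinear (tensor_lift f) \<and> (\<forall>a b. tensor_lift f (a \<otimes> b) = f a b)"
    unfolding tensor_lift_def by (rule theI')
  thus "clinear (tensor_lift f)" "tensor_lift f (a \<otimes> b) = f a b" by auto
qed

definition tensor_map ::
  "('a::complex_vector \<Rightarrow> 'c::complex_vector) \<Rightarrow> ('b::complex_vector \<Rightarrow> 'd::complex_vector) \<Rightarrow>
    'a \<otimes> 'b \<Rightarrow> 'c \<otimes> 'd" where
  "tensor_map f g = tensor_lift (\<lambda>a b. f a \<otimes> g b)"

definition tensor_flip :: "'a::complex_vector \<otimes> 'b::complex_vector \<Rightarrow> 'b \<otimes> 'a" where
  "tensor_flip = tensor_lift (\<lambda>a b. b \<otimes> a)"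

definition tensor_assoc ::
  "('a::complex_vector \<otimes> 'b::complex_vector) \<otimes> 'c::complex_vector \<Rightarrow> 'a \<otimes> 'b \<otimes> 'c" where
  "tensor_assoc = tensor_lift (\<lambda>x c. tensor_lift (\<lambda>a b. a \<otimes> b \<otimes> c) x)"

definition tensor_mult ::
  "('a::complex_vector \<Rightarrow> 'a \<Rightarrow> 'a) \<Rightarrow> ('b::complex_vector \<Rightarrow> 'b \<Rightarrow> 'b) \<Rightarrow>
    'a \<otimes> 'b \<Rightarrow> 'a \<otimes> 'b \<Rightarrow> 'a \<otimes> 'b" where
  "tensor_mult m n x y = tensor_lift (\<lambda>a b. tensor_lift (\<lambda>c d. m a c \<otimes> n b d) y) x"

text \<open>For subspaces \<^term>\<open>P\<close> and \<^term>\<open>Q\<close> of two ambient spaces, \<open>P \<otimes> Q\<close> is identified with its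
  image in the tensor product of the ambient spaces (over a field the canonical map is injective).\<close>

definition tensor_sub ::
  "'a::complex_vector set \<Rightarrow> 'b::complex_vector set \<Rightarrow> ('a \<otimes> 'b) set" where
  "tensor_sub P Q = cv.span {p \<otimes> q |p q. p \<in> P \<and> q \<in> Q}"


section \<open>Algebras on subspaces\<close>

text \<open>The join algebra is a subspace \<^term>\<open>P\<close> of an ambient vector space whose product depends on
  the coaction, so algebras are given as a carrier, a product and a unit. Since every linear or
  bilinear map extends from a subspace to the ambient space, all structure maps live on the ambient
  space, and the algebraic laws are imposed on \<^term>\<open>P\<close> only.\<close>

definition complex_algebra_on :: "'p::complex_vector set \<Rightarrow> ('p \<Rightarrow> 'p \<Rightarrow> 'p) \<Rightarrow> 'p \<Rightarrow> bool" where
  "complex_algebra_on P m u \<longleftrightarrow>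
     cv.subspace P \<and> cbilinear m \<and> u \<in> P \<and>
     (\<forall>x\<in>P. \<forall>y\<in>P. m x y \<in> P) \<and>
     (\<forall>x\<in>P. \<forall>y\<in>P. \<forall>z\<in>P. m (m x y) z = m x (m y z)) \<and>
     (\<forall>x\<in>P. m u x = x \<and> m x u = x)"

definition algebra_isomorphic ::
  "'p::complex_vector set \<Rightarrow> ('p \<Rightarrow> 'p \<Rightarrow> 'p) \<Rightarrow> 'p \<Rightarrow>
   'q::complex_vector set \<Rightarrow> ('q \<Rightarrow> 'q \<Rightarrow> 'q) \<Rightarrow> 'q \<Rightarrow> bool" where
  "algebra_isomorphic P m u Q n v \<longleftrightarrow>
     complex_algebra_on P m u \<and> complex_algebra_on Q n v \<and>
     (\<exists>\<phi>. bij_betw \<phi> P Q \<and> \<phi> u = v \<and>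
        (\<forall>x\<in>P. \<forall>y\<in>P. \<phi> (x + y) = \<phi> x + \<phi> y \<and> \<phi> (m x y) = n (\<phi> x) (\<phi> y)) \<and>
        (\<forall>c. \<forall>x\<in>P. \<phi> (c *\<^sub>C x) = c *\<^sub>C \<phi> x))"


section \<open>Hopf algebras, comodule algebras and Galois objects\<close>

locale hopf_algebra =
  fixes \<Delta> :: "'h::complex_algebra_1 \<Rightarrow> 'h \<otimes> 'h"
    and \<epsilon> :: "'h \<Rightarrow> complex"
    and S :: "'h \<Rightarrow> 'h"
  assumes linear_comult: "clinear \<Delta>"
    and linear_counit: "clinear \<epsilon>"
    and linear_antipode: "clinear S"
    and coassoc: "tensor_assoc (tensor_map \<Delta> id (\<Delta> h)) = tensor_map id \<Delta> (\<Delta> h)"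
    and counit_left: "tensor_lift (\<lambda>a b. \<epsilon> a *\<^sub>C b) (\<Delta> h) = h"
    and counit_right: "tensor_lift (\<lambda>a b. \<epsilon> b *\<^sub>C a) (\<Delta> h) = h"
    and comult_mult: "\<Delta> (h * k) = tensor_mult (*) (*) (\<Delta> h) (\<Delta> k)"
    and comult_one: "\<Delta> 1 = 1 \<otimes> 1"
    and counit_mult: "\<epsilon> (h * k) = \<epsilon> h * \<epsilon> k"
    and counit_one: "\<epsilon> 1 = 1"
    and antipode_left: "tensor_lift (\<lambda>a b. S a * b) (\<Delta> h) = \<epsilon> h *\<^sub>C 1"
    and antipode_right: "tensor_lift (\<lambda>a b. a * S b) (\<Delta> h) = \<epsilon> h *\<^sub>C 1"

locale right_comodule_algebra =
  fixes \<Delta> :: "'h::complex_algebra_1 \<Rightarrow> 'h \<otimes> 'h"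
    and \<epsilon> :: "'h \<Rightarrow> complex"
    and P :: "'p::complex_vector set"
    and m :: "'p \<Rightarrow> 'p \<Rightarrow> 'p"
    and u :: 'p
    and \<delta> :: "'p \<Rightarrow> 'p \<otimes> 'h"
  assumes algebra: "complex_algebra_on P m u"
    and linear_coaction: "clinear \<delta>"
    and coaction_closed: "p \<in> P \<Longrightarrow> \<delta> p \<in> tensor_sub P UNIV"
    and coaction_coassoc: "p \<in> P \<Longrightarrow> tensor_assoc (tensor_map \<delta> id (\<delta> p)) = tensor_map id \<Delta> (\<delta> p)"
    and coaction_counit: "p \<in> P \<Longrightarrow> tensor_lift (\<lambda>q h. \<epsilon> h *\<^sub>C q) (\<delta> p) = p"
    and coaction_mult: "p \<in> P \<Longrightarrow> q \<in> P \<Longrightarrow> \<delta> (m p q) = tensor_mult m (*) (\<delta> p) (\<delta> q)"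
    and coaction_unit: "\<delta> u = u \<otimes> 1"

locale left_comodule_algebra =
  fixes \<Delta> :: "'h::complex_algebra_1 \<Rightarrow> 'h \<otimes> 'h"
    and \<epsilon> :: "'h \<Rightarrow> complex"
    and Q :: "'q::complex_vector set"
    and m :: "'q \<Rightarrow> 'q \<Rightarrow> 'q"
    and u :: 'q
    and \<gamma> :: "'q \<Rightarrow> 'h \<otimes> 'q"
  assumes algebra: "complex_algebra_on Q m u"
    and linear_coaction: "clinear \<gamma>"
    and coaction_closed: "q \<in> Q \<Longrightarrow> \<gamma> q \<in> tensor_sub UNIV Q"
    and coaction_coassoc: "q \<in> Q \<Longrightarrow> tensor_assoc (tensor_map \<Delta> id (\<gamma> q)) = tensor_map id \<gamma> (\<gamma> q)"
    and coaction_counit: "q \<in> Q \<Longrightarrow> tensor_lift (\<lambda>h p. \<epsilon> h *\<^sub>C p) (\<gamma> q) = q"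
    and coaction_mult: "p \<in> Q \<Longrightarrow> q \<in> Q \<Longrightarrow> \<gamma> (m p q) = tensor_mult (*) m (\<gamma> p) (\<gamma> q)"
    and coaction_unit: "\<gamma> u = 1 \<otimes> u"

definition bicomodule_algebra ::
  "('h::complex_algebra_1 \<Rightarrow> 'h \<otimes> 'h) \<Rightarrow> ('h \<Rightarrow> complex) \<Rightarrow>
   ('a::complex_algebra_1 \<Rightarrow> 'h \<otimes> 'a) \<Rightarrow> ('a \<Rightarrow> 'a \<otimes> 'h) \<Rightarrow> bool" where
  "bicomodule_algebra \<Delta> \<epsilon> \<gamma> \<delta> \<longleftrightarrow>
     left_comodule_algebra \<Delta> \<epsilon> UNIV (*) 1 \<gamma> \<and>
     right_comodule_algebra \<Delta> \<epsilon> UNIV (*) 1 \<delta> \<and>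
     (\<forall>a. tensor_assoc (tensor_map \<gamma> id (\<delta> a)) = tensor_map id \<delta> (\<gamma> a))"

definition right_coinvariants ::
  "'p::complex_vector set \<Rightarrow> ('p \<Rightarrow> 'p \<otimes> 'h::complex_algebra_1) \<Rightarrow> 'p set" where
  "right_coinvariants P \<delta> = {p \<in> P. \<delta> p = p \<otimes> 1}"

definition left_coinvariants ::
  "'q::complex_vector set \<Rightarrow> ('q \<Rightarrow> 'h::complex_algebra_1 \<otimes> 'q) \<Rightarrow> 'q set" where
  "left_coinvariants Q \<gamma> = {q \<in> Q. \<gamma> q = 1 \<otimes> q}"

definition right_can ::
  "('p::complex_vector \<Rightarrow> 'p \<Rightarrow> 'p) \<Rightarrow> ('p \<Rightarrow> 'p \<otimes> 'h::complex_algebra_1) \<Rightarrow> 'p \<otimes> 'p \<Rightarrow> 'p \<otimes> 'h" where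
  "right_can m \<delta> = tensor_lift (\<lambda>p q. tensor_lift (\<lambda>q\<^sub>0 q\<^sub>1. m p q\<^sub>0 \<otimes> q\<^sub>1) (\<delta> q))"

definition left_can ::
  "('q::complex_vector \<Rightarrow> 'q \<Rightarrow> 'q) \<Rightarrow> ('q \<Rightarrow> 'h::complex_algebra_1 \<otimes> 'q) \<Rightarrow> 'q \<otimes> 'q \<Rightarrow> 'h \<otimes> 'q" where
  "left_can m \<gamma> = tensor_lift (\<lambda>p q. tensor_lift (\<lambda>p\<^sub>1 p\<^sub>0. p\<^sub>1 \<otimes> m p\<^sub>0 q) (\<gamma> p))"

definition right_galois_object :: "('a::complex_algebra_1 \<Rightarrow> 'a \<otimes> 'h::complex_algebra_1) \<Rightarrow> bool" where
  "right_galois_object \<delta> \<longleftrightarrow> right_coinvariants UNIV \<delta> = scalars \<and> bij (right_can (*) \<delta>)"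

definition left_galois_object :: "('a::complex_algebra_1 \<Rightarrow> 'h::complex_algebra_1 \<otimes> 'a) \<Rightarrow> bool" where
  "left_galois_object \<gamma> \<longleftrightarrow> left_coinvariants UNIV \<gamma> = scalars \<and> bij (left_can (*) \<gamma>)"


section \<open>Strong connections and principality\<close>

text \<open>The second canonical map in the definition of a strong connection,
  \<open>p \<otimes> q \<mapsto> (p \<otimes> 1) \<delta>(q)\<close>, is \<^const>\<open>right_can\<close>.\<close>

definition strong_connection ::
  "('h::complex_algebra_1 \<Rightarrow> 'h \<otimes> 'h) \<Rightarrow> ('h \<Rightarrow> 'h) \<Rightarrow>
   'p::complex_vector set \<Rightarrow> ('p \<Rightarrow> 'p \<Rightarrow> 'p) \<Rightarrow> 'p \<Rightarrow> ('p \<Rightarrow> 'p \<otimes> 'h) \<Rightarrow> ('h \<Rightarrow> 'p \<otimes> 'p) \<Rightarrow> bool" where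
  "strong_connection \<Delta> S P m u \<delta> l \<longleftrightarrow>
     (let \<delta>L = (\<lambda>p. tensor_map (inv S) id (tensor_flip (\<delta> p))) in
      clinear l \<and> (\<forall>h. l h \<in> tensor_sub P P) \<and> l 1 = u \<otimes> u \<and>
      (\<forall>h. tensor_map id \<delta> (l h) = tensor_assoc (tensor_map l id (\<Delta> h))) \<and>
      (\<forall>h. tensor_assoc (tensor_map \<delta>L id (l h)) = tensor_map id l (\<Delta> h)) \<and>
      (\<forall>h. right_can m \<delta> (l h) = u \<otimes> h))"

definition principal_coaction ::
  "('h::complex_algebra_1 \<Rightarrow> 'h \<otimes> 'h) \<Rightarrow> ('h \<Rightarrow> complex) \<Rightarrow> ('h \<Rightarrow> 'h) \<Rightarrow>
   'p::complex_vector set \<Rightarrow> ('p \<Rightarrow> 'p \<Rightarrow> 'p) \<Rightarrow> 'p \<Rightarrow> ('p \<Rightarrow> 'p \<otimes> 'h) \<Rightarrow> bool" where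
  "principal_coaction \<Delta> \<epsilon> S P m u \<delta> \<longleftrightarrow>
     right_comodule_algebra \<Delta> \<epsilon> P m u \<delta> \<and> (\<exists>l. strong_connection \<Delta> S P m u \<delta> l)"


section \<open>Continuous functions on the unit interval\<close>

text \<open>Functions are normalised to vanish off \<open>[0,1]\<close>, so that two of them are equal as soon as they
  agree on \<open>[0,1]\<close>.\<close>

typedef cont01 = "{f :: real \<Rightarrow> complex. continuous_on {0..1} f \<and> (\<forall>t. t \<notin> {0..1} \<longrightarrow> f t = 0)}"
  morphisms ev Cont01
  by (rule exI[of _ "\<lambda>_. 0"]) simp

setup_lifting type_definition_cont01

instantiation cont01 :: complex_algebra_1
begin
lift_definition zero_cont01 :: cont01 is "\<lambda>_. 0" by simp
lift_definition one_cont01 :: cont01 is "\<lambda>t. if t \<in> {0..1} then 1 else 0"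
proof -
  have "continuous_on {0..1} (\<lambda>t::real. if t \<in> {0..1} then 1 else (0::complex)) =
      continuous_on {0..1} (\<lambda>t::real. 1::complex)"
    by (intro continuous_on_cong) auto
  thus ?thesis by (auto simp: continuous_on_const)
qed
lift_definition plus_cont01 :: "cont01 \<Rightarrow> cont01 \<Rightarrow> cont01" is "\<lambda>f g t. f t + g t"
  by (auto intro: continuous_on_add)
lift_definition minus_cont01 :: "cont01 \<Rightarrow> cont01 \<Rightarrow> cont01" is "\<lambda>f g t. f t - g t"
  by (auto intro: continuous_on_diff)
lift_definition uminus_cont01 :: "cont01 \<Rightarrow> cont01" is "\<lambda>f t. - f t"
  by (auto intro: continuous_on_minus)
lift_definition times_cont01 :: "cont01 \<Rightarrow> cont01 \<Rightarrow> cont01" is "\<lambda>f g t. f t * g t"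
  by (auto intro: continuous_on_mult)
lift_definition scaleC_cont01 :: "complex \<Rightarrow> cont01 \<Rightarrow> cont01" is "\<lambda>c f t. c * f t"
  by (auto intro: continuous_on_mult_left)
instance
proof
  show "(0::cont01) \<noteq> 1"
    by transfer (auto simp: fun_eq_iff intro!: exI[of _ 0])
qed (transfer; force simp: fun_eq_iff algebra_simps)+
end

text \<open>The map \<open>ev\<^sub>r \<otimes> id\<close>, with values in \<open>V\<close> instead of \<open>\<complex> \<otimes> V\<close>.\<close>

definition eval_at :: "real \<Rightarrow> cont01 \<otimes> 'v::complex_vector \<Rightarrow> 'v" where
  "eval_at r = tensor_lift (\<lambda>f v. ev f r *\<^sub>C v)"


section \<open>The braided join algebra and the unreduced suspension\<close>

definition braided_mult ::
  "('a::complex_algebra_1 \<Rightarrow> 'h::complex_algebra_1 \<otimes> 'a) \<Rightarrow> 'a \<otimes> 'a \<Rightarrow> 'a \<otimes> 'a \<Rightarrow> 'a \<otimes> 'a" where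
  "braided_mult \<gamma> x y =
     inv (left_can (*) \<gamma>) (tensor_mult (*) (*) (left_can (*) \<gamma> x) (left_can (*) \<gamma> y))"

definition join_carrier :: "(cont01 \<otimes> 'a::complex_algebra_1 \<otimes> 'a) set" where
  "join_carrier = {x. eval_at 0 x \<in> tensor_sub scalars UNIV \<and> eval_at 1 x \<in> tensor_sub UNIV scalars}"

definition join_mult ::
  "('a::complex_algebra_1 \<Rightarrow> 'h::complex_algebra_1 \<otimes> 'a) \<Rightarrow>
    cont01 \<otimes> 'a \<otimes> 'a \<Rightarrow> cont01 \<otimes> 'a \<otimes> 'a \<Rightarrow> cont01 \<otimes> 'a \<otimes> 'a" where
  "join_mult \<gamma> = tensor_mult (*) (braided_mult \<gamma>)"

definition join_unit :: "cont01 \<otimes> 'a::complex_algebra_1 \<otimes> 'a" where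
  "join_unit = 1 \<otimes> 1 \<otimes> 1"

definition diagonal_coaction ::
  "('a::complex_algebra_1 \<Rightarrow> 'a \<otimes> 'h::complex_algebra_1) \<Rightarrow> 'a \<otimes> 'a \<Rightarrow> ('a \<otimes> 'a) \<otimes> 'h" where
  "diagonal_coaction \<delta> = tensor_lift (\<lambda>a b.
     tensor_lift (\<lambda>a\<^sub>0 a\<^sub>1. tensor_lift (\<lambda>b\<^sub>0 b\<^sub>1. (a\<^sub>0 \<otimes> b\<^sub>0) \<otimes> (a\<^sub>1 * b\<^sub>1)) (\<delta> b)) (\<delta> a))"

definition join_coaction ::
  "('a::complex_algebra_1 \<Rightarrow> 'a \<otimes> 'h::complex_algebra_1) \<Rightarrow>
    cont01 \<otimes> 'a \<otimes> 'a \<Rightarrow> (cont01 \<otimes> 'a \<otimes> 'a) \<otimes> 'h" where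
  "join_coaction \<delta> =
     tensor_lift (\<lambda>f x. tensor_lift (\<lambda>y h. (f \<otimes> y) \<otimes> h) (diagonal_coaction \<delta> x))"

definition unreduced_suspension :: "(cont01 \<otimes> 'h::complex_algebra_1) set" where
  "unreduced_suspension = {g. eval_at 0 g \<in> scalars \<and> eval_at 1 g \<in> scalars}"

end

theory Submission
  imports Defs
begin

text \<open>The canonical map \<open>can : A \<otimes> A \<rightarrow> H \<otimes> A\<close> turns the braided product into the tensor product algebra
  \<open>H \<otimes> A\<close> and, by the bicomodule property, the diagonal coaction into \<open>id \<otimes> \<delta>\<close>. Hence the join algebra is
  a comodule algebra, and its coinvariants come from \<open>C([0,1]) \<otimes> H \<otimes> A\<^bsup>co H\<^esup> = C([0,1]) \<otimes> H\<close> with the boundary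
  conditions of the suspension.

  Both \<open>x \<mapsto> 1 \<otimes> x\<close> and \<open>x \<mapsto> x \<otimes> 1\<close> are colinear algebra maps \<open>A \<rightarrow> A \<otimes> A\<close>, so suitable combinations
  \<open>f \<otimes> 1 \<otimes> x + g \<otimes> x \<otimes> 1\<close> with \<open>f(1) = g(0) = 0\<close> are colinear maps into the join. Pushing the translation
  map \<open>h \<mapsto> can\<^bsup>-1\<^esup>(1 \<otimes> h)\<close> of the right Galois object forward along a sum of pairs of such maps, with
  coefficients chosen so that the mixed products cancel on the diagonal, gives a strong connection.\<close>

section \<open>Linear maps and tensor products\<close>

text \<open>Linearity is proved by descent through the term: \<open>intro clin\<close> peels off one
  operation at a time. The same rules, given to the simplifier, discharge the linearity premises of
  equations such as \<open>tensor_map_tensor\<close>.\<close>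

named_theorems clin

lemma clinear_ident [clin]: "clinear (\<lambda>x. x)" "clinear id"
  by (simp_all add: clinear_iff)

lemma clinear_comp: "clinear f \<Longrightarrow> clinear g \<Longrightarrow> clinear (\<lambda>x. f (g x))"
  by (simp add: clinear_iff)

lemma clinear_add: "clinear f \<Longrightarrow> f (x + y) = f x + f y"
  by (simp add: clinear_iff)

lemma clinear_sum: "clinear f \<Longrightarrow> f (sum g A) = (\<Sum>a\<in>A. f (g a))"
  by (induction A rule: infinite_finite_induct) (auto simp: clinear_zero clinear_iff)

lemma clinear_plus [clin]: "clinear f \<Longrightarrow> clinear g \<Longrightarrow> clinear (\<lambda>x. f x + g x)"
  by (simp add: clinear_iff scaleC_add_right algebra_simps)

lemma clinear_sum_fun [clin]: "(\<And>a. clinear (f a)) \<Longrightarrow> clinear (\<lambda>x. \<Sum>a\<in>A. f a x)"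
  by (simp add: clinear_iff sum.distrib cv.scale_sum_right)

lemma clinear_scaleC [clin]: "clinear f \<Longrightarrow> clinear (\<lambda>x. c *\<^sub>C f x)"
  by (simp add: clinear_iff scaleC_add_right mult.commute)

lemma clinear_scaleC_left [clin]: "clinear f \<Longrightarrow> clinear (\<lambda>x. f x *\<^sub>C v)"
  by (simp add: clinear_iff scaleC_add_left scaleC_complex_def)

lemma clinear_times_left [clin]:
  "clinear f \<Longrightarrow> clinear (\<lambda>x. f x * (b::'a::complex_algebra_1))"
  by (simp add: clinear_iff algebra_simps)

lemma clinear_times_right [clin]:
  "clinear f \<Longrightarrow> clinear (\<lambda>x. (b::'a::complex_algebra_1) * f x)"
  by (simp add: clinear_iff algebra_simps)

lemma cbilinearI [clin]:
  "(\<And>a. clinear (f a)) \<Longrightarrow> (\<And>b. clinear (\<lambda>a. f a b)) \<Longrightarrow> cbilinear f"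
  by (simp add: cbilinear_def)

lemma cbilinear_left: "cbilinear f \<Longrightarrow> clinear g \<Longrightarrow> clinear (\<lambda>x. f (g x) b)"
  by (simp add: cbilinear_def clinear_iff)

lemma cbilinear_right: "cbilinear f \<Longrightarrow> clinear g \<Longrightarrow> clinear (\<lambda>x. f b (g x))"
  by (simp add: cbilinear_def clinear_iff)

lemma
  assumes "cbilinear f"
  shows cbilinear_add_left: "f (x + y) a = f x a + f y a"
    and cbilinear_scaleC_left: "f (c *\<^sub>C x) a = c *\<^sub>C f x a"
    and cbilinear_add_right: "f u (v + w) = f u v + f u w"
    and cbilinear_scaleC_right: "f u (c *\<^sub>C v) = c *\<^sub>C f u v"
  using assms by (simp_all add: cbilinear_def clinear_iff)

lemma cbilinear_times [clin]: "cbilinear ((*) :: 'a::complex_algebra_1 \<Rightarrow> 'a \<Rightarrow> 'a)"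
  by (intro clin)

lemmas tensor_add_left = cbilinear_add_left[OF cbilinear_tensor]
  and tensor_add_right = cbilinear_add_right[OF cbilinear_tensor]
  and tensor_scaleC_left = cbilinear_scaleC_left[OF cbilinear_tensor]
  and tensor_scaleC_right = cbilinear_scaleC_right[OF cbilinear_tensor]

lemma clinear_tensor_left [clin]: "clinear f \<Longrightarrow> clinear (\<lambda>x. f x \<otimes> b)"
  by (rule cbilinear_left[OF cbilinear_tensor])

lemma clinear_tensor_right [clin]: "clinear f \<Longrightarrow> clinear (\<lambda>x. a \<otimes> f x)"
  by (rule cbilinear_right[OF cbilinear_tensor])

lemma tensor_zero_left [simp]: "0 \<otimes> b = 0" and tensor_zero_right [simp]: "a \<otimes> 0 = 0"
  using clinear_zero[OF clinear_tensor_left[OF clinear_ident(1)]]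
    clinear_zero[OF clinear_tensor_right[OF clinear_ident(1)]] by auto

lemma clinear_tensor_lift_comp [clin]:
  "cbilinear F \<Longrightarrow> clinear f \<Longrightarrow> clinear (\<lambda>x. tensor_lift F (f x))"
  by (rule clinear_comp[OF clinear_tensor_lift])

lemma tensor_eqI:
  assumes "clinear f" "clinear g" "\<And>a b. f (a \<otimes> b) = g (a \<otimes> b)"
  shows "f x = g x"
  using tensor_ext[OF assms] by simp

text \<open>Since \<open>tensor_lift\<close> is a definite description, linearity in the parameter
  is read off from uniqueness: both sides are linear in the tensor and agree on pure
  tensors.\<close>

lemma clinear_tensor_lift_param [clin]:
  assumes "\<And>p. cbilinear (F p)" "\<And>a b. clinear (\<lambda>p. F p a b)"
  shows "clinear (\<lambda>p. tensor_lift (F p) x)"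
  unfolding clinear_iff
proof (intro conjI allI)
  fix p q c
  have F: "F (p + q) a b = F p a b + F q a b" "F (c *\<^sub>C p) a b = c *\<^sub>C F p a b" for a b
    using assms(2)[of a b] by (simp_all add: clinear_iff)
  have "tensor_lift (F (p + q)) = (\<lambda>x. tensor_lift (F p) x + tensor_lift (F q) x)"
    by (rule tensor_ext)
      (simp_all only: tensor_lift_tensor assms(1) F clinear_plus clinear_tensor_lift)
  thus "tensor_lift (F (p + q)) x = tensor_lift (F p) x + tensor_lift (F q) x"
    by (rule fun_cong)
  have "tensor_lift (F (c *\<^sub>C p)) = (\<lambda>x. c *\<^sub>C tensor_lift (F p) x)"
    by (rule tensor_ext)
      (simp_all only: tensor_lift_tensor assms(1) F clinear_scaleC clinear_tensor_lift)
  thus "tensor_lift (F (c *\<^sub>C p)) x = c *\<^sub>C tensor_lift (F p) x"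
    by (rule fun_cong)
qed

lemma tensor_map_tensor [simp]:
  "clinear f \<Longrightarrow> clinear g \<Longrightarrow> tensor_map f g (a \<otimes> b) = f a \<otimes> g b"
  unfolding tensor_map_def
  by (rule tensor_lift_tensor) (auto intro!: clin)

lemma clinear_tensor_map [clin]:
  "clinear f \<Longrightarrow> clinear g \<Longrightarrow> clinear h \<Longrightarrow> clinear (\<lambda>x. tensor_map f g (h x))"
  unfolding tensor_map_def by (intro clin)

lemma clinear_tensor_map_param1 [clin]:
  assumes "\<And>p. clinear (f p)" "\<And>a. clinear (\<lambda>p. f p a)" "clinear g"
  shows "clinear (\<lambda>p. tensor_map (f p) g x)"
  unfolding tensor_map_def by (intro assms clin)

lemma clinear_tensor_map_param2 [clin]:
  assumes "\<And>p. clinear (g p)" "\<And>a. clinear (\<lambda>p. g p a)" "clinear f"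
  shows "clinear (\<lambda>p. tensor_map f (g p) x)"
  unfolding tensor_map_def by (intro assms clin)

lemma tensor_map_comp:
  assumes "clinear f" "clinear g" "clinear f'" "clinear g'"
  shows "tensor_map f g (tensor_map f' g' x) = tensor_map (\<lambda>a. f (f' a)) (\<lambda>b. g (g' b)) x"
  by (rule tensor_eqI[where x = x]) (intro assms clin assms[THEN clinear_comp], intro assms clin assms[THEN clinear_comp],
      simp add: assms assms(1,2)[THEN clinear_comp] assms(3,4))

lemma tensor_map_id [simp]: "tensor_map id id x = x"
  and tensor_map_ident [simp]: "tensor_map (\<lambda>x. x) (\<lambda>x. x) x = x"
  by (rule tensor_eqI[where x = x], (intro clin)+, simp add: clinear_ident)+

lemma tensor_map_ident_fun [simp]: "tensor_map (\<lambda>x. x) (\<lambda>x. x) = (\<lambda>x. x)"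
  by (rule ext) simp

lemma tensor_map_add_left:
  assumes "clinear f" "clinear g" "clinear h"
  shows "tensor_map (\<lambda>x. f x + g x) h z = tensor_map f h z + tensor_map g h z"
  by (rule fun_cong[OF tensor_ext], (intro clin assms)+) (simp add: assms clin tensor_add_left)

lemma tensor_map_add_right:
  assumes "clinear f" "clinear g" "clinear h"
  shows "tensor_map h (\<lambda>x. f x + g x) z = tensor_map h f z + tensor_map h g z"
  by (rule fun_cong[OF tensor_ext], (intro clin assms)+) (simp add: assms clin tensor_add_right)

lemma tensor_assoc_tensor [simp]: "tensor_assoc ((a \<otimes> b) \<otimes> c) = a \<otimes> b \<otimes> c"
  unfolding tensor_assoc_def
  by (simp add: tensor_lift_tensor clin)

lemma clinear_tensor_assoc [clin]: "clinear f \<Longrightarrow> clinear (\<lambda>x. tensor_assoc (f x))"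
  unfolding tensor_assoc_def by (intro clin)

lemma tensor_flip_tensor [simp]: "tensor_flip (a \<otimes> b) = b \<otimes> a"
  unfolding tensor_flip_def by (simp add: tensor_lift_tensor clin)

lemma clinear_tensor_flip [clin]: "clinear f \<Longrightarrow> clinear (\<lambda>x. tensor_flip (f x))"
  unfolding tensor_flip_def by (intro clin)

lemma tensor_flip_flip [simp]: "tensor_flip (tensor_flip x) = x"
  by (rule fun_cong[OF tensor_ext], (intro clin)+, simp)

section \<open>Slices and subspaces of tensor products\<close>

text \<open>The inverse of \<open>tensor_assoc\<close>. In this form its value on a \<otimes> x is a
  \<open>tensor_map\<close> even when x is not a pure tensor, as for x = \<delta> q.\<close>

definition tensor_unassoc ::
  "'a::complex_vector \<otimes> 'b::complex_vector \<otimes> 'c::complex_vector \<Rightarrow> ('a \<otimes> 'b) \<otimes> 'c" where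
  "tensor_unassoc = tensor_lift (\<lambda>a. tensor_map (\<lambda>b. a \<otimes> b) id)"

lemma tensor_unassoc_tensor: "tensor_unassoc (a \<otimes> x) = tensor_map (\<lambda>b. a \<otimes> b) id x"
  unfolding tensor_unassoc_def by (simp add: tensor_lift_tensor clin)

lemma clinear_tensor_unassoc [clin]: "clinear f \<Longrightarrow> clinear (\<lambda>x. tensor_unassoc (f x))"
  unfolding tensor_unassoc_def by (intro clin)

lemma tensor_unassoc_tensor3 [simp]: "tensor_unassoc (a \<otimes> b \<otimes> c) = (a \<otimes> b) \<otimes> c"
  by (simp add: tensor_unassoc_tensor clin)

lemma tensor_ext3:
  fixes f g :: "'a::complex_vector \<otimes> 'b::complex_vector \<otimes> 'c::complex_vector \<Rightarrow> 'd::complex_vector"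
  assumes "clinear f" "clinear g" "\<And>a b c. f (a \<otimes> b \<otimes> c) = g (a \<otimes> b \<otimes> c)"
  shows "f = g"
proof (rule tensor_ext[OF assms(1,2)])
  fix a x
  have "(\<lambda>x. f (a \<otimes> x)) = (\<lambda>x. g (a \<otimes> x))"
    by (rule tensor_ext) (intro clin clinear_comp[OF assms(1)] clinear_comp[OF assms(2)] assms(3))+
  thus "f (a \<otimes> x) = g (a \<otimes> x)" by (rule fun_cong)
qed

lemma tensor_ext3':
  fixes f g :: "('a::complex_vector \<otimes> 'b::complex_vector) \<otimes> 'c::complex_vector \<Rightarrow> 'd::complex_vector"
  assumes "clinear f" "clinear g" "\<And>a b c. f ((a \<otimes> b) \<otimes> c) = g ((a \<otimes> b) \<otimes> c)"
  shows "f = g"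
proof (rule tensor_ext[OF assms(1,2)])
  fix x c
  have "(\<lambda>x. f (x \<otimes> c)) = (\<lambda>x. g (x \<otimes> c))"
    by (rule tensor_ext) (intro clin clinear_comp[OF assms(1)] clinear_comp[OF assms(2)] assms(3))+
  thus "f (x \<otimes> c) = g (x \<otimes> c)" by (rule fun_cong)
qed

lemma tensor_unassoc_assoc [simp]: "tensor_unassoc (tensor_assoc x) = x"
  by (rule fun_cong[OF tensor_ext3'], (intro clin)+, simp)

lemma tensor_assoc_unassoc [simp]: "tensor_assoc (tensor_unassoc x) = x"
  by (rule fun_cong[OF tensor_ext3], (intro clin)+, simp)

lemma tensor_assoc_map:
  assumes "clinear f" "clinear g" "clinear h"
  shows "tensor_assoc (tensor_map (tensor_map f g) h x) = tensor_map f (tensor_map g h) (tensor_assoc x)"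
  by (rule fun_cong[OF tensor_ext3'], (intro clin assms)+, simp add: assms clin)

lemma tensor_assoc_inject: "tensor_assoc x = tensor_assoc y \<longleftrightarrow> x = y"
  by (metis tensor_unassoc_assoc)

lemma clinear_left_inverse:
  fixes f :: "'a::complex_vector \<Rightarrow> 'b::complex_vector"
  assumes "clinear f" "inj f"
  obtains g where "clinear g" "\<And>x. g (f x) = x"
proof -
  interpret vector_space_pair "scaleC :: complex \<Rightarrow> 'a \<Rightarrow> 'a" "scaleC :: complex \<Rightarrow> 'b \<Rightarrow> 'b" ..
  obtain g where "clinear g" "g \<circ> f = id"
    using linear_injective_left_inverse[OF assms] by blast
  thus thesis using that by (metis comp_apply id_apply)
qed

text \<open>Over a field, injective linear maps split, and the tensor product of the two left
  inverses is a left inverse. This is what later allows bijective maps such as \<open>can\<close>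
  and \<open>S\<close> to be cancelled on a single leg.\<close>

lemma inj_tensor_map:
  assumes f: "clinear f" "inj f" and g: "clinear g" "inj g"
  shows "inj (tensor_map f g)"
proof -
  obtain f' where f': "clinear f'" "\<And>x. f' (f x) = x" using clinear_left_inverse[OF f] by blast
  obtain g' where g': "clinear g'" "\<And>x. g' (g x) = x" using clinear_left_inverse[OF g] by blast
  have "tensor_map f' g' (tensor_map f g x) = x" for x
    by (subst tensor_map_comp) (simp_all add: f g f' g')
  thus ?thesis by (rule inj_on_inverseI)
qed

lemma clinear_inv:
  assumes "clinear f" "bij f"
  shows "clinear (inv f)"
  unfolding clinear_iff
proof (intro conjI allI)
  have [simp]: "f (inv f y) = y" for y using assms(2) by (simp add: bij_is_surj surj_f_inv_f)
  have *: "inv f y = x" if "f x = y" for x y using assms(2) that by (metis bij_is_inj inv_f_f)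
  show "inv f (x + y) = inv f x + inv f y" for x y
    by (rule *) (use assms(1) in \<open>simp add: clinear_iff\<close>)
  show "inv f (c *\<^sub>C x) = c *\<^sub>C inv f x" for c x
    by (rule *) (use assms(1) in \<open>simp add: clinear_iff\<close>)
qed

definition slice_right ::
  "('h::complex_vector \<Rightarrow> complex) \<Rightarrow> 'v::complex_vector \<otimes> 'h \<Rightarrow> 'v" where
  "slice_right \<phi> = tensor_lift (\<lambda>v h. \<phi> h *\<^sub>C v)"

definition slice_left ::
  "('h::complex_vector \<Rightarrow> complex) \<Rightarrow> 'h \<otimes> 'v::complex_vector \<Rightarrow> 'v" where
  "slice_left \<phi> = tensor_lift (\<lambda>h v. \<phi> h *\<^sub>C v)"

lemma slice_right_tensor [simp]: "clinear \<phi> \<Longrightarrow> slice_right \<phi> (v \<otimes> h) = \<phi> h *\<^sub>C v"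
  unfolding slice_right_def by (subst tensor_lift_tensor) (intro clin, assumption, simp)

lemma slice_left_tensor [simp]: "clinear \<phi> \<Longrightarrow> slice_left \<phi> (h \<otimes> v) = \<phi> h *\<^sub>C v"
  unfolding slice_left_def by (subst tensor_lift_tensor) (intro clin, assumption, simp)

lemma clinear_slice_right [clin]:
  "clinear \<phi> \<Longrightarrow> clinear f \<Longrightarrow> clinear (\<lambda>x. slice_right \<phi> (f x))"
  unfolding slice_right_def by (intro clin)

lemma clinear_slice_left [clin]:
  "clinear \<phi> \<Longrightarrow> clinear f \<Longrightarrow> clinear (\<lambda>x. slice_left \<phi> (f x))"
  unfolding slice_left_def by (intro clin)

lemma slice_right_map:
  assumes "clinear \<phi>" "clinear f"
  shows "slice_right \<phi> (tensor_map f id x) = f (slice_right \<phi> x)"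
  by (rule fun_cong[OF tensor_ext], (intro clin clinear_comp[OF assms(2)] assms)+)
    (insert assms, simp add: clin, simp add: clinear_iff)

lemma slice_left_map:
  assumes "clinear \<phi>" "clinear f"
  shows "slice_left \<phi> (tensor_map id f x) = f (slice_left \<phi> x)"
  by (rule fun_cong[OF tensor_ext], (intro clin clinear_comp[OF assms(2)] assms)+)
    (insert assms, simp add: clin, simp add: clinear_iff)

lemma slice_left_flip: "clinear \<phi> \<Longrightarrow> slice_left \<phi> (tensor_flip x) = slice_right \<phi> x"
  by (rule fun_cong[OF tensor_ext], (intro clin | assumption)+, simp)

text \<open>The functionals \<open>r b\<close> are the coordinates of a basis of the second factor,
  so the coefficients of y in that basis are slices of y itself.\<close>

lemma tensor_basis_expansion:
  fixes y :: "'v::complex_vector \<otimes> 'h::complex_vector"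
  obtains F r where "finite F" "\<And>b. clinear (r b)" "y = (\<Sum>b\<in>F. slice_right (r b) y \<otimes> b)"
proof -
  define B where "B = cv.extend_basis ({} :: 'h set)"
  have B: "cv.independent B" "cv.span B = UNIV"
    unfolding B_def using cv.independent_extend_basis[OF cv.independent_empty]
      cv.span_extend_basis[OF cv.independent_empty] by auto
  define r where "r b h = cv.representation B h b" for b h
  have r: "clinear (r b)" for b
    using B by (auto simp: clinear_iff r_def cv.representation_add cv.representation_scale scaleC_complex_def)
  \<comment> \<open>The expansion is claimed for every finite set above F, so that in the induction
    the supports of two summands can be merged.\<close>
  have "\<exists>F. finite F \<and> (\<forall>G. finite G \<longrightarrow> F \<subseteq> G \<longrightarrow> y = (\<Sum>b\<in>G. slice_right (r b) y \<otimes> b))"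
    (is "?P y")
  proof -
    have lin: "clinear (\<lambda>y::'v \<otimes> 'h. \<Sum>b\<in>G. slice_right (r b) y \<otimes> b)" for G
      by (intro clin r)
    have "y \<in> cv.span {v \<otimes> h |(v::'v) (h::'h). True}" by (subst span_tensors) simp
    thus ?thesis
    proof (induction rule: cv.span_induct_alt)
      case base
      show ?case using lin[THEN clinear_zero] by auto
    next
      case (step c x y)
      then obtain v h where x: "x = v \<otimes> h" by blast
      obtain F where F: "finite F" "\<And>G. finite G \<Longrightarrow> F \<subseteq> G \<Longrightarrow> y = (\<Sum>b\<in>G. slice_right (r b) y \<otimes> b)"
        using step by blast
      let ?K = "{b. r b h \<noteq> 0}"
      have K: "finite ?K" unfolding r_def by (rule cv.finite_representation)
      show ?case
      proof (intro exI[of _ "F \<union> ?K"] conjI allI impI)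
        show "finite (F \<union> ?K)" using F K by simp
        fix G assume G: "finite G" "F \<union> ?K \<subseteq> G"
        have "h = (\<Sum>b\<in>?K. r b h *\<^sub>C b)"
          unfolding r_def using cv.sum_nonzero_representation_eq[OF B(1), of h] B(2) by simp
        also have "\<dots> = (\<Sum>b\<in>G. r b h *\<^sub>C b)"
          using G by (intro sum.mono_neutral_left) auto
        finally have "v \<otimes> h = (\<Sum>b\<in>G. v \<otimes> (r b h *\<^sub>C b))"
          using clinear_sum[OF clinear_tensor_right[OF clinear_ident(1)], of v] by metis
        moreover have "v \<otimes> (r b h *\<^sub>C b) = slice_right (r b) x \<otimes> b" for b
          by (simp add: x r tensor_scaleC_left tensor_scaleC_right)
        ultimately have ex: "x = (\<Sum>b\<in>G. slice_right (r b) x \<otimes> b)"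
          by (simp only: x)
        have ey: "y = (\<Sum>b\<in>G. slice_right (r b) y \<otimes> b)" using F(2)[of G] G by simp
        have "(\<Sum>b\<in>G. slice_right (r b) (c *\<^sub>C x + y) \<otimes> b) =
            c *\<^sub>C (\<Sum>b\<in>G. slice_right (r b) x \<otimes> b) + (\<Sum>b\<in>G. slice_right (r b) y \<otimes> b)"
          using lin[of G] unfolding clinear_iff by simp
        thus "c *\<^sub>C x + y = (\<Sum>b\<in>G. slice_right (r b) (c *\<^sub>C x + y) \<otimes> b)"
          by (simp only: ex[symmetric] ey[symmetric])
      qed
    qed
  qed
  thus thesis using that r by blast
qed

text \<open>All coefficients in the basis expansion of y are slices. Membership in a tensor product
  of subspaces can thus be tested after applying functionals, which commute with maps on the other
  leg.\<close>

lemma tensor_sub_rightI: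
  assumes "\<And>\<phi>. clinear \<phi> \<Longrightarrow> slice_right \<phi> y \<in> P"
  shows "y \<in> tensor_sub P UNIV"
proof -
  obtain F r where F: "finite F" "\<And>b. clinear (r b)" "y = (\<Sum>b\<in>F. slice_right (r b) y \<otimes> b)"
    using tensor_basis_expansion[of y] by blast
  show ?thesis
    unfolding tensor_sub_def by (subst F(3)) (blast intro: cv.span_sum cv.span_base assms F)
qed

lemma tensor_sub_subset:
  "cv.subspace W \<Longrightarrow> (\<And>p q. p \<in> P \<Longrightarrow> q \<in> Q \<Longrightarrow> p \<otimes> q \<in> W) \<Longrightarrow> tensor_sub P Q \<subseteq> W"
  unfolding tensor_sub_def by (rule cv.span_minimal) auto

lemma subspace_tensor_sub: "cv.subspace (tensor_sub P Q)"
  unfolding tensor_sub_def by (rule cv.subspace_span)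

lemma tensor_sub_UNIV: "tensor_sub UNIV UNIV = UNIV"
  unfolding tensor_sub_def using span_tensors by simp

lemma tensor_sub_base: "p \<in> P \<Longrightarrow> q \<in> Q \<Longrightarrow> p \<otimes> q \<in> tensor_sub P Q"
  unfolding tensor_sub_def by (rule cv.span_base) blast

lemma subspace_vimage: "clinear f \<Longrightarrow> cv.subspace W \<Longrightarrow> cv.subspace (f -` W)"
  by (simp add: cv.subspace_def clinear_zero) (simp add: clinear_iff)

lemma subspace_range: "clinear f \<Longrightarrow> cv.subspace (range f)"
  by (auto simp: cv.subspace_def clinear_iff simp flip: clinear_zero)
    (metis rangeI)+

lemma tensor_map_in_tensor_sub:
  assumes "clinear f" "clinear g" "\<And>a. f a \<in> P" "\<And>b. g b \<in> Q"
  shows "tensor_map f g x \<in> tensor_sub P Q"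
proof -
  have "tensor_sub UNIV UNIV \<subseteq> tensor_map f g -` tensor_sub P Q"
    by (rule tensor_sub_subset)
      (auto intro!: subspace_vimage subspace_tensor_sub tensor_sub_base clinear_tensor_map[OF assms(1,2) clinear_ident(1)] simp: assms)
  thus ?thesis by (auto simp: tensor_sub_UNIV)
qed

lemma tensor_sub_leftI:
  assumes "\<And>\<phi>. clinear \<phi> \<Longrightarrow> slice_left \<phi> y \<in> P"
  shows "y \<in> tensor_sub UNIV P"
proof -
  have "tensor_flip y \<in> tensor_sub P UNIV"
    by (rule tensor_sub_rightI) (use assms in \<open>simp flip: slice_left_flip\<close>)
  moreover have "tensor_sub P UNIV \<subseteq> tensor_flip -` tensor_sub UNIV P"
    by (rule tensor_sub_subset, intro subspace_vimage subspace_tensor_sub clinear_tensor_flip[OF clinear_ident(1)])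
      (simp add: tensor_sub_base)
  ultimately show ?thesis by auto
qed

lemma subspace_scalars: "cv.subspace scalars"
  unfolding scalars_def by (rule subspace_range) (intro clin)

text \<open>Scalars move across the tensor sign. With its mirror image this turns the boundary
  conditions of the join into explicit ranges.\<close>

lemma tensor_sub_scalars_left: "tensor_sub scalars UNIV = range (\<lambda>a. 1 \<otimes> a)"
proof
  show "tensor_sub scalars UNIV \<subseteq> range (\<lambda>a. 1 \<otimes> a)"
    by (rule tensor_sub_subset, intro subspace_range clin)
      (auto simp: scalars_def tensor_scaleC_left simp flip: tensor_scaleC_right)
  have "1 \<in> scalars" unfolding scalars_def by (metis scaleC_one rangeI)
  thus "range (\<lambda>a. 1 \<otimes> a) \<subseteq> tensor_sub scalars UNIV" by (auto intro: tensor_sub_base)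
qed

lemma tensor_sub_scalars_right: "tensor_sub UNIV scalars = range (\<lambda>a. a \<otimes> 1)"
proof
  show "tensor_sub UNIV scalars \<subseteq> range (\<lambda>a. a \<otimes> 1)"
    by (rule tensor_sub_subset, intro subspace_range clin)
      (auto simp: scalars_def tensor_scaleC_right simp flip: tensor_scaleC_left)
  have "1 \<in> scalars" unfolding scalars_def by (metis scaleC_one rangeI)
  thus "range (\<lambda>a. a \<otimes> 1) \<subseteq> tensor_sub UNIV scalars" by (auto intro: tensor_sub_base)
qed

section \<open>The componentwise product on a tensor product\<close>

lemma cbilinear_tensor_mult:
  assumes "cbilinear m" "cbilinear n"
  shows "cbilinear (tensor_mult m n)"
  unfolding tensor_mult_def
  by (intro clin assms cbilinear_left[OF assms(1)] cbilinear_left[OF assms(2)]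
      cbilinear_right[OF assms(1)] cbilinear_right[OF assms(2)])

lemma tensor_mult_tensor:
  assumes "cbilinear m" "cbilinear n"
  shows "tensor_mult m n (a \<otimes> b) (c \<otimes> d) = m a c \<otimes> n b d"
proof -
  have 1: "cbilinear (\<lambda>a b. tensor_lift (\<lambda>c d. m a c \<otimes> n b d) y)" for y
    by (intro clin assms cbilinear_left[OF assms(1)] cbilinear_left[OF assms(2)]
      cbilinear_right[OF assms(1)] cbilinear_right[OF assms(2)])
  have 2: "cbilinear (\<lambda>c d. m a c \<otimes> n b d)" for a b
    by (intro clin cbilinear_right[OF assms(1)] cbilinear_right[OF assms(2)])
  show ?thesis unfolding tensor_mult_def
    by (subst tensor_lift_tensor[OF 1], subst tensor_lift_tensor[OF 2]) simp
qed

lemma bilinear_tensor_ext: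
  fixes f g :: "'a::complex_vector \<otimes> 'b::complex_vector \<Rightarrow> 'c::complex_vector \<otimes> 'd::complex_vector \<Rightarrow> 'e::complex_vector"
  assumes "cbilinear f" "cbilinear g"
    and "\<And>a b c d. f (a \<otimes> b) (c \<otimes> d) = g (a \<otimes> b) (c \<otimes> d)"
  shows "f = g"
proof (intro ext)
  fix x y
  have "f (a \<otimes> b) = g (a \<otimes> b)" for a b
    by (rule tensor_ext) (use assms in \<open>simp_all add: cbilinear_def\<close>)
  hence "(\<lambda>x. f x y) = (\<lambda>x. g x y)"
    by (intro tensor_ext) (use assms in \<open>simp_all add: cbilinear_def\<close>)
  thus "f x y = g x y" by (rule fun_cong)
qed

lemma tensor_mult_map:
  assumes f: "clinear f" "\<And>x y. f (m x y) = m' (f x) (f y)"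
    and g: "clinear g" "\<And>x y. g (n x y) = n' (g x) (g y)"
    and bl: "cbilinear m" "cbilinear n" "cbilinear m'" "cbilinear n'"
  shows "tensor_map f g (tensor_mult m n x y) = tensor_mult m' n' (tensor_map f g x) (tensor_map f g y)"
proof -
  have "(\<lambda>x y. tensor_map f g (tensor_mult m n x y)) =
      (\<lambda>x y. tensor_mult m' n' (tensor_map f g x) (tensor_map f g y))"
    by (rule bilinear_tensor_ext)
      (intro clin f(1) g(1) cbilinear_left[OF cbilinear_tensor_mult] cbilinear_right[OF cbilinear_tensor_mult] bl
       | simp add: tensor_mult_tensor bl f g)+
  thus ?thesis by (simp add: fun_eq_iff)
qed

section \<open>Extending coactions to tensor products\<close>

lemma complex_algebra_on_UNIV: "complex_algebra_on UNIV (*) (1 :: 'a::complex_algebra_1)"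
  by (simp add: complex_algebra_on_def cbilinear_times mult.assoc)

lemma complex_algebra_on_subset:
  assumes "complex_algebra_on P m u" "cv.subspace Q" "Q \<subseteq> P" "u \<in> Q"
    and "\<And>x y. x \<in> Q \<Longrightarrow> y \<in> Q \<Longrightarrow> m x y \<in> Q"
  shows "complex_algebra_on Q m u"
  using assms unfolding complex_algebra_on_def by (simp add: subset_iff)

lemma tensor_mult_algebra:
  assumes m: "complex_algebra_on UNIV m u" and n: "complex_algebra_on UNIV n v"
  shows "complex_algebra_on UNIV (tensor_mult m n) (u \<otimes> v)"
proof -
  have bl: "cbilinear m" "cbilinear n" using m n by (simp_all add: complex_algebra_on_def)
  note bt = cbilinear_tensor_mult[OF bl]
  note [simp] = tensor_mult_tensor[OF bl]
  let ?t = "tensor_mult m n"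
  have "?t (?t x y) z = ?t x (?t y z)" for x y z
  proof -
    \<comment> \<open>The third factor is first fixed to a pure tensor, since
      \<open>bilinear_tensor_ext\<close> treats two arguments; linearity then frees it.\<close>
    have *: "(\<lambda>x y. ?t (?t x y) (e \<otimes> f)) = (\<lambda>x y. ?t x (?t y (e \<otimes> f)))" for e f
      by (rule bilinear_tensor_ext)
       (intro clin cbilinear_left[OF bt] cbilinear_right[OF bt]
        | use m n in \<open>simp add: complex_algebra_on_def\<close>)+
    have "(\<lambda>z. ?t (?t x y) z) = (\<lambda>z. ?t x (?t y z))"
      by (rule tensor_ext) (intro clin cbilinear_left[OF bt] cbilinear_right[OF bt] fun_cong[OF fun_cong[OF *]])+
    thus ?thesis by (rule fun_cong)
  qed
  moreover have "?t (u \<otimes> v) x = x" for x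
    by (rule fun_cong[OF tensor_ext], (intro clin cbilinear_right[OF bt])+)
      (use m n in \<open>simp add: complex_algebra_on_def\<close>)
  moreover have "?t x (u \<otimes> v) = x" for x
    by (rule fun_cong[OF tensor_ext], (intro clin cbilinear_left[OF bt])+)
      (use m n in \<open>simp add: complex_algebra_on_def\<close>)
  ultimately show ?thesis by (simp add: complex_algebra_on_def bt)
qed

text \<open>This is id \<otimes> \<delta>, rebracketed so that the coacting algebra is the outermost
  right leg.\<close>

definition left_extend ::
  "('p::complex_vector \<Rightarrow> 'q::complex_vector \<otimes> 'h::complex_vector) \<Rightarrow>
    'b::complex_vector \<otimes> 'p \<Rightarrow> ('b \<otimes> 'q) \<otimes> 'h" where
  "left_extend \<delta> = tensor_lift (\<lambda>b p. tensor_map (\<lambda>y. b \<otimes> y) id (\<delta> p))"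

lemma left_extend_tensor:
  assumes "clinear \<delta>"
  shows "left_extend \<delta> (b \<otimes> p) = tensor_map (\<lambda>y. b \<otimes> y) id (\<delta> p)"
  unfolding left_extend_def by (rule tensor_lift_tensor) (intro clin assms)

lemma clinear_left_extend [clin]:
  "clinear \<delta> \<Longrightarrow> clinear f \<Longrightarrow> clinear (\<lambda>x. left_extend \<delta> (f x))"
  unfolding left_extend_def by (intro clin)

lemma left_extend_unassoc:
  assumes "clinear \<delta>"
  shows "left_extend \<delta> x = tensor_unassoc (tensor_map id \<delta> x)"
  by (rule fun_cong[OF tensor_ext], (intro clin assms)+)
    (simp add: left_extend_tensor tensor_unassoc_tensor assms clin)

text \<open>A functional on the left leg and a coaction on the right leg do not interact. Evaluation
  at a point of the interval is the main instance.\<close>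

lemma slice_left_extend:
  assumes "clinear \<delta>" "clinear \<phi>"
  shows "tensor_map (slice_left \<phi>) id (left_extend \<delta> x) = \<delta> (slice_left \<phi> x)"
proof -
  have \<delta>: "\<delta> (c *\<^sub>C p) = c *\<^sub>C \<delta> p" for c p
    using assms(1) by (simp add: clinear_iff)
  have "tensor_map (\<lambda>y. c *\<^sub>C y) id z = c *\<^sub>C z" for c and z :: "'b \<otimes> 'c"
    by (rule fun_cong[OF tensor_ext], (intro clin)+) (simp add: clin tensor_scaleC_left)
  hence "(\<lambda>x. tensor_map (slice_left \<phi>) id (left_extend \<delta> x)) = (\<lambda>x. \<delta> (slice_left \<phi> x))"
    by (intro tensor_ext clin assms clinear_comp[OF assms(1)])
      (simp add: left_extend_tensor assms tensor_map_comp clin id_def \<delta>)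
  thus ?thesis by (rule fun_cong)
qed

text \<open>Slicing commutes with id \<otimes> \<delta>, so every left slice of x is coinvariant,
  and slices detect membership.\<close>

lemma left_extend_coinvariant:
  fixes \<delta> :: "'p::complex_vector \<Rightarrow> 'p \<otimes> 'h::complex_algebra_1" and x :: "'b::complex_vector \<otimes> 'p"
  assumes "clinear \<delta>" "left_extend \<delta> x = x \<otimes> 1"
  shows "x \<in> tensor_sub UNIV (right_coinvariants UNIV \<delta>)"
proof (rule tensor_sub_leftI)
  fix \<phi> :: "'b \<Rightarrow> complex" assume "clinear \<phi>"
  thus "slice_left \<phi> x \<in> right_coinvariants UNIV \<delta>"
    by (simp add: right_coinvariants_def assms clin flip: slice_left_extend)
qed

context
  fixes \<Delta> :: "'h::complex_algebra_1 \<Rightarrow> 'h \<otimes> 'h" and \<epsilon> :: "'h \<Rightarrow> complex"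
  assumes \<Delta>: "clinear \<Delta>" and \<epsilon>: "clinear \<epsilon>"
begin

text \<open>The coaction touches only the second factor, so on b \<otimes> p each law is the law for
  \<delta> with b carried along. It is applied with first factor H, for the target of
  \<open>can\<close>, and with first factor C([0,1]), for the join.\<close>

lemma left_extend_comodule_algebra:
  assumes R: "right_comodule_algebra \<Delta> \<epsilon> UNIV m u \<delta>" and n: "complex_algebra_on UNIV n v"
  shows "right_comodule_algebra \<Delta> \<epsilon> UNIV (tensor_mult n m) (v \<otimes> u) (left_extend \<delta>)"
proof -
  interpret right_comodule_algebra \<Delta> \<epsilon> UNIV m u \<delta> by (rule R)
  note lin = linear_coaction
  have bl: "cbilinear m" "cbilinear n" using algebra n by (simp_all add: complex_algebra_on_def)
  note bnm = cbilinear_tensor_mult[OF bl(2,1)]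
    and bm = cbilinear_tensor_mult[OF bl(1) cbilinear_times]
    and bnmh = cbilinear_tensor_mult[OF cbilinear_tensor_mult[OF bl(2,1)] cbilinear_times]
  show ?thesis
  proof (rule right_comodule_algebra.intro)
    show "complex_algebra_on UNIV (tensor_mult n m) (v \<otimes> u)"
      by (rule tensor_mult_algebra[OF n algebra])
    show "clinear (left_extend \<delta>)" by (intro clin lin)
    show "left_extend \<delta> p \<in> tensor_sub UNIV UNIV" for p by (simp add: tensor_sub_UNIV)
    show "left_extend \<delta> (v \<otimes> u) = (v \<otimes> u) \<otimes> 1"
      by (simp add: left_extend_tensor lin coaction_unit clin)
    have "(\<lambda>p. slice_right \<epsilon> (left_extend \<delta> p)) = (\<lambda>p. p)"
    proof (rule tensor_ext, intro clin lin \<epsilon>, intro clin)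
      show "slice_right \<epsilon> (left_extend \<delta> (b \<otimes> p)) = b \<otimes> p" for b p
        using coaction_counit[of p] unfolding slice_right_def[symmetric]
        by (simp add: left_extend_tensor lin slice_right_map \<epsilon> clin)
    qed
    thus "tensor_lift (\<lambda>q h. \<epsilon> h *\<^sub>C q) (left_extend \<delta> p) = p" for p
      unfolding slice_right_def by (rule fun_cong)
    have "(\<lambda>p. tensor_assoc (tensor_map (left_extend \<delta>) id (left_extend \<delta> p))) =
        (\<lambda>p. tensor_map id \<Delta> (left_extend \<delta> p))"
    proof (rule tensor_ext, intro clin lin, intro clin lin \<Delta>)
      fix b p
      have "tensor_map (left_extend \<delta>) id (left_extend \<delta> (b \<otimes> p)) =
          tensor_map (\<lambda>y. tensor_map (\<lambda>y. b \<otimes> y) id (\<delta> y)) id (\<delta> p)"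
        by (simp add: left_extend_tensor lin) (subst tensor_map_comp, (intro clin lin)+, simp add: left_extend_tensor lin id_def)
      also have "\<dots> = tensor_map (tensor_map (\<lambda>y. b \<otimes> y) id) id (tensor_map \<delta> id (\<delta> p))"
        by (subst tensor_map_comp, (intro clin lin)+, simp add: id_def)
      also have "tensor_assoc \<dots> = tensor_map (\<lambda>y. b \<otimes> y) (tensor_map id id) (tensor_assoc (tensor_map \<delta> id (\<delta> p)))"
        by (rule tensor_assoc_map) (intro clin)+
      also have "\<dots> = tensor_map (\<lambda>y. b \<otimes> y) (tensor_map id id) (tensor_map id \<Delta> (\<delta> p))"
        by (simp only: coaction_coassoc UNIV_I)
      also have "\<dots> = tensor_map id \<Delta> (left_extend \<delta> (b \<otimes> p))"
        by (simp add: left_extend_tensor lin) (subst (1 2) tensor_map_comp, (intro clin lin \<Delta>)+, simp)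
      finally show "tensor_assoc (tensor_map (left_extend \<delta>) id (left_extend \<delta> (b \<otimes> p))) =
        tensor_map id \<Delta> (left_extend \<delta> (b \<otimes> p))" .
    qed
    thus "tensor_assoc (tensor_map (left_extend \<delta>) id (left_extend \<delta> p)) =
        tensor_map id \<Delta> (left_extend \<delta> p)" for p
      by (rule fun_cong)
    have "(\<lambda>p q. left_extend \<delta> (tensor_mult n m p q)) =
        (\<lambda>p q. tensor_mult (tensor_mult n m) (*) (left_extend \<delta> p) (left_extend \<delta> q))"
    proof (rule bilinear_tensor_ext)
      show "cbilinear (\<lambda>p q. left_extend \<delta> (tensor_mult n m p q))"
        by (intro clin lin cbilinear_left[OF bnm] cbilinear_right[OF bnm])
      show "cbilinear (\<lambda>p q. tensor_mult (tensor_mult n m) (*) (left_extend \<delta> p) (left_extend \<delta> q))"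
        by (intro clin lin cbilinear_left[OF bnmh] cbilinear_right[OF bnmh])
      fix a b c d
      \<comment> \<open>The two coaction values are replaced by arbitrary tensors X and Y, which
        makes the identity bilinear and hence checkable on pure tensors.\<close>
      have "(\<lambda>X Y. tensor_map (\<lambda>y. n a c \<otimes> y) id (tensor_mult m (*) X Y)) =
        (\<lambda>X Y. tensor_mult (tensor_mult n m) (*) (tensor_map (\<lambda>y. a \<otimes> y) id X) (tensor_map (\<lambda>y. c \<otimes> y) (id :: 'h \<Rightarrow> _) Y))"
        by (rule bilinear_tensor_ext)
          (intro clin cbilinear_left[OF bm] cbilinear_right[OF bm] cbilinear_left[OF bnmh] cbilinear_right[OF bnmh]
          | simp add: tensor_mult_tensor bl bnm cbilinear_times clin)+
      from fun_cong[OF fun_cong[OF this]]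
      show "left_extend \<delta> (tensor_mult n m (a \<otimes> b) (c \<otimes> d)) =
        tensor_mult (tensor_mult n m) (*) (left_extend \<delta> (a \<otimes> b)) (left_extend \<delta> (c \<otimes> d))"
        by (simp add: tensor_mult_tensor bl left_extend_tensor lin coaction_mult)
    qed
    thus "left_extend \<delta> (tensor_mult n m p q) =
      tensor_mult (tensor_mult n m) (*) (left_extend \<delta> p) (left_extend \<delta> q)" for p q
      by (simp add: fun_eq_iff)
  qed
qed

lemma comodule_algebra_subset:
  assumes R: "right_comodule_algebra \<Delta> \<epsilon> UNIV m u \<delta>" and "complex_algebra_on P m u"
    and "\<And>p. p \<in> P \<Longrightarrow> \<delta> p \<in> tensor_sub P UNIV"
  shows "right_comodule_algebra \<Delta> \<epsilon> P m u \<delta>"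
  using assms unfolding right_comodule_algebra_def by simp

text \<open>Each law holds because it holds after the injective maps \<Phi> or \<Phi> \<otimes> id.
  With \<Phi> = \<open>can\<close> this gives associativity of the braided product and all comodule
  laws of the diagonal coaction.\<close>

lemma comodule_algebra_transport:
  assumes R: "right_comodule_algebra \<Delta> \<epsilon> UNIV m u \<delta>"
    and \<Phi>: "clinear \<Phi>" "bij \<Phi>"
    and m': "\<And>x y. \<Phi> (m' x y) = m (\<Phi> x) (\<Phi> y)" and u': "\<Phi> u' = u"
    and \<delta>': "clinear \<delta>'" "\<And>x. tensor_map \<Phi> id (\<delta>' x) = \<delta> (\<Phi> x)"
  shows "right_comodule_algebra \<Delta> \<epsilon> UNIV m' u' \<delta>'"
proof -
  interpret right_comodule_algebra \<Delta> \<epsilon> UNIV m u \<delta> by (rule R)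
  have inj: "\<Phi> x = \<Phi> y \<longleftrightarrow> x = y" for x y using \<Phi>(2) by (metis bij_is_inj injD)
  have inj1: "tensor_map \<Phi> id x = tensor_map \<Phi> id y \<longleftrightarrow> x = y" for x y :: "'b \<otimes> 'c::complex_vector"
    using inj_tensor_map[OF \<Phi>(1) bij_is_inj[OF \<Phi>(2)] clinear_ident(2) inj_on_id] by (metis injD)
  have bl: "cbilinear m" using algebra by (simp add: complex_algebra_on_def)
  have [simp]: "\<Phi> (x + y) = \<Phi> x + \<Phi> y" "\<Phi> (c *\<^sub>C x) = c *\<^sub>C \<Phi> x" for x y c
    using \<Phi>(1) by (simp_all add: clinear_iff)
  have bl': "cbilinear m'"
    using bl by (auto simp: cbilinear_def clinear_iff inj[symmetric] m')
  show ?thesis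
  proof (rule right_comodule_algebra.intro)
    show "complex_algebra_on UNIV m' u'"
      using algebra bl' by (simp add: complex_algebra_on_def inj[symmetric] m' u')
    show "clinear \<delta>'" by (rule \<delta>')
    show "\<delta>' p \<in> tensor_sub UNIV UNIV" for p by (simp add: tensor_sub_UNIV)
    show "\<delta>' u' = u' \<otimes> 1"
      by (simp add: inj1[symmetric] \<delta>' u' coaction_unit \<Phi> clin)
    show "tensor_lift (\<lambda>q h. \<epsilon> h *\<^sub>C q) (\<delta>' p) = p" for p
      using coaction_counit[of "\<Phi> p"] unfolding slice_right_def[symmetric]
      by (simp add: inj[symmetric] slice_right_map[OF \<epsilon> \<Phi>(1), symmetric] \<delta>')
    show "tensor_assoc (tensor_map \<delta>' id (\<delta>' p)) = tensor_map id \<Delta> (\<delta>' p)" for p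
    proof -
      have "tensor_map \<Phi> id (tensor_assoc (tensor_map \<delta>' id (\<delta>' p))) =
          tensor_assoc (tensor_map (tensor_map \<Phi> id) id (tensor_map \<delta>' id (\<delta>' p)))"
        by (subst tensor_assoc_map) (simp_all add: \<Phi> clin id_def)
      also have "tensor_map (tensor_map \<Phi> id) id (tensor_map \<delta>' id (\<delta>' p)) =
          tensor_map \<delta> id (\<delta> (\<Phi> p))"
        by (simp add: tensor_map_comp \<Phi> \<delta>'(1) linear_coaction clin id_def flip: \<delta>'(2))
      also have "tensor_assoc \<dots> = tensor_map id \<Delta> (\<delta> (\<Phi> p))" by (rule coaction_coassoc) simp
      also have "\<dots> = tensor_map \<Phi> id (tensor_map id \<Delta> (\<delta>' p))"
        by (simp add: tensor_map_comp \<Phi> \<delta>'(1) \<Delta> clin id_def flip: \<delta>'(2))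
      finally show ?thesis by (simp only: inj1)
    qed
    show "\<delta>' (m' p q) = tensor_mult m' (*) (\<delta>' p) (\<delta>' q)" for p q
    proof -
      have "tensor_map \<Phi> id (tensor_mult m' (*) (\<delta>' p) (\<delta>' q)) =
         tensor_mult m (*) (tensor_map \<Phi> id (\<delta>' p)) (tensor_map \<Phi> id (\<delta>' q))"
        by (rule tensor_mult_map) (simp_all add: \<Phi> m' bl bl' clin)
      also have "\<dots> = tensor_map \<Phi> id (\<delta>' (m' p q))"
        by (simp add: \<delta>' m' coaction_mult)
      finally show ?thesis by (simp only: inj1)
    qed
  qed
qed

end

section \<open>The braided join algebra\<close>

lemma clinear_ev: "clinear (\<lambda>f. ev f r)"
  by (simp add: clinear_iff plus_cont01.rep_eq scaleC_cont01.rep_eq scaleC_complex_def)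

text \<open>Evaluation is a slice, so \<open>slice_left_map\<close> and
  \<open>slice_left_extend\<close> apply to it.\<close>

lemma eval_at_slice: "eval_at r = slice_left (\<lambda>f. ev f r)"
  by (simp add: eval_at_def slice_left_def)

lemma clinear_eval_at [clin]: "clinear f \<Longrightarrow> clinear (\<lambda>x. eval_at r (f x))"
  unfolding eval_at_slice by (intro clin clinear_ev)

lemma eval_at_tensor [simp]: "eval_at r (f \<otimes> v) = ev f r *\<^sub>C v"
  by (simp add: eval_at_slice clinear_ev)

lemma eval_at_map: "clinear f \<Longrightarrow> eval_at r (tensor_map id f x) = f (eval_at r x)"
  unfolding eval_at_slice by (rule slice_left_map[OF clinear_ev])

lemma eval_at_mult:
  assumes "cbilinear m"
  shows "eval_at r (tensor_mult (*) m x y) = m (eval_at r x) (eval_at r y)"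
proof -
  note bl = cbilinear_tensor_mult[OF cbilinear_times assms]
  have "(\<lambda>x y. eval_at r (tensor_mult (*) m x y)) = (\<lambda>x y. m (eval_at r x) (eval_at r y))"
    by (rule bilinear_tensor_ext)
      (intro clin cbilinear_left[OF bl] cbilinear_right[OF bl] cbilinear_left[OF assms] cbilinear_right[OF assms]
      | simp add: tensor_mult_tensor cbilinear_times assms times_cont01.rep_eq
          cbilinear_scaleC_left[OF assms] cbilinear_scaleC_right[OF assms])+
  thus ?thesis by (simp add: fun_eq_iff)
qed

lemma tensor_map_times_right:
  "tensor_map id (\<lambda>a. a * b) w = tensor_mult (*) (*) w (1 \<otimes> b)"
  for w :: "'h::complex_algebra_1 \<otimes> 'a::complex_algebra_1"
  by (rule fun_cong[OF tensor_ext],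
      (intro clin cbilinear_left[OF cbilinear_tensor_mult] cbilinear_times)+)
    (simp add: tensor_mult_tensor cbilinear_times clin)

locale bigalois =
  fixes \<Delta> :: "'h::complex_algebra_1 \<Rightarrow> 'h \<otimes> 'h"
    and \<epsilon> :: "'h \<Rightarrow> complex"
    and S :: "'h \<Rightarrow> 'h"
    and \<gamma> :: "'a::complex_algebra_1 \<Rightarrow> 'h \<otimes> 'a"
    and \<delta> :: "'a \<Rightarrow> 'a \<otimes> 'h"
  assumes hopf: "hopf_algebra \<Delta> \<epsilon> S"
    and bij_S: "bij S"
    and bicomodule: "bicomodule_algebra \<Delta> \<epsilon> \<gamma> \<delta>"
    and left_galois: "left_galois_object \<gamma>"
    and right_galois: "right_galois_object \<delta>"
begin

sublocale hopf_algebra \<Delta> \<epsilon> S by (rule hopf)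

sublocale L: left_comodule_algebra \<Delta> \<epsilon> UNIV "(*)" 1 \<gamma>
  using bicomodule by (simp add: bicomodule_algebra_def)

sublocale R: right_comodule_algebra \<Delta> \<epsilon> UNIV "(*)" 1 \<delta>
  using bicomodule by (simp add: bicomodule_algebra_def)

lemma clinear_coactions [clin]:
  "clinear f \<Longrightarrow> clinear (\<lambda>x. \<gamma> (f x))" "clinear g \<Longrightarrow> clinear (\<lambda>x. \<delta> (g x))"
  "clinear \<gamma>" "clinear \<delta>"
  by (rule clinear_comp[OF L.linear_coaction] clinear_comp[OF R.linear_coaction]
    L.linear_coaction R.linear_coaction, assumption?)+

abbreviation can where "can \<equiv> left_can (*) \<gamma>"

abbreviation bmult (infixl "\<bullet>" 70) where "bmult \<equiv> braided_mult \<gamma>"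

text \<open>Writing the value as a product in H \<otimes> A lets multiplicativity of id \<otimes>
  \<delta> act on it in \<open>can_diagonal\<close>.\<close>

lemma can_tensor: "can (a \<otimes> b) = tensor_mult (*) (*) (\<gamma> a) (1 \<otimes> b)"
proof -
  have "can (a \<otimes> b) = tensor_map id (\<lambda>p. p * b) (\<gamma> a)"
    unfolding left_can_def tensor_map_def by (subst tensor_lift_tensor) (simp_all add: clin)
  thus ?thesis by (simp only: tensor_map_times_right)
qed

lemma clinear_can [clin]: "clinear f \<Longrightarrow> clinear (\<lambda>x. can (f x))" "clinear can"
  unfolding left_can_def by (intro clin; assumption?)+

lemma bij_can: "bij can" using left_galois by (simp add: left_galois_object_def)

lemma can_inject: "can x = can y \<longleftrightarrow> x = y"
  using bij_can by (metis bij_is_inj injD)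

lemma can_inv [simp]: "can (inv can x) = x"
  using bij_can by (simp add: bij_is_surj surj_f_inv_f)

lemma tensor_algebra_HA: "complex_algebra_on UNIV (tensor_mult (*) (*)) (1 \<otimes> 1 :: 'h \<otimes> 'a)"
  by (rule tensor_mult_algebra[OF complex_algebra_on_UNIV complex_algebra_on_UNIV])

lemma can_left [simp]: "can (1 \<otimes> x) = 1 \<otimes> x"
  by (simp add: can_tensor L.coaction_unit tensor_mult_tensor cbilinear_times)

lemma can_right [simp]: "can (x \<otimes> 1) = \<gamma> x"
  using tensor_algebra_HA by (simp add: can_tensor complex_algebra_on_def)

lemma can_bmult: "can (x \<bullet> y) = tensor_mult (*) (*) (can x) (can y)"
  by (simp add: braided_mult_def)

text \<open>Since can(a \<otimes> b) = \<gamma>(a)(1 \<otimes> b) and id \<otimes> \<delta> is an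
  algebra map, the two factors can be treated separately: commuting coactions handle \<gamma>(a),
  and on 1 \<otimes> b the map is \<delta> with 1 carried along.\<close>

lemma can_diagonal: "tensor_map can id (diagonal_coaction \<delta> x) = left_extend \<delta> (can x)"
proof -
  interpret E: right_comodule_algebra \<Delta> \<epsilon> UNIV "tensor_mult (*) (*)" "1 \<otimes> 1 :: 'h \<otimes> 'a" "left_extend \<delta>"
    by (rule left_extend_comodule_algebra[OF linear_comult linear_counit R.right_comodule_algebra_axioms complex_algebra_on_UNIV])
  note b1 = cbilinear_tensor_mult[OF cbilinear_times cbilinear_times]
  note b2 = cbilinear_tensor_mult[OF b1 cbilinear_times]
  let ?m = "tensor_mult (tensor_mult (*) (*)) (*) :: ('h \<otimes> 'a) \<otimes> 'h \<Rightarrow> _"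
  \<comment> \<open>X and Y stand for \<delta> a and \<delta> b; freeing them reduces the claim to
    pure tensors.\<close>
  have key: "(\<lambda>X Y. tensor_map can id
      (tensor_lift (\<lambda>a\<^sub>0 a\<^sub>1. tensor_lift (\<lambda>b\<^sub>0 b\<^sub>1. (a\<^sub>0 \<otimes> b\<^sub>0) \<otimes> (a\<^sub>1 * b\<^sub>1)) Y) X)) =
      (\<lambda>X Y. ?m (tensor_map \<gamma> id X) (tensor_map (\<lambda>y. 1 \<otimes> y) id Y))"
    by (rule bilinear_tensor_ext)
     (intro clin cbilinear_left[OF b2] cbilinear_right[OF b2]
      | simp add: tensor_lift_tensor tensor_mult_tensor b1 b2 can_tensor cbilinear_times clin)+
  have "(\<lambda>x. tensor_map can id (diagonal_coaction \<delta> x)) = (\<lambda>x. left_extend \<delta> (can x))"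
  proof (rule tensor_ext)
    show "clinear (\<lambda>x. tensor_map can id (diagonal_coaction \<delta> x))"
      unfolding diagonal_coaction_def by (intro clin)
    show "clinear (\<lambda>x. left_extend \<delta> (can x))" by (intro clin)
    fix a b
    have "tensor_map can id (diagonal_coaction \<delta> (a \<otimes> b)) =
        ?m (tensor_map \<gamma> id (\<delta> a)) (tensor_map (\<lambda>y. 1 \<otimes> y) id (\<delta> b))"
      unfolding diagonal_coaction_def
      by (subst tensor_lift_tensor, intro clin) (rule fun_cong[OF fun_cong[OF key]])
    \<comment> \<open>This is the bicomodule condition, up to the bracketing.\<close>
    also have "tensor_map \<gamma> id (\<delta> a) = left_extend \<delta> (\<gamma> a)"
      using bicomodule by (simp add: bicomodule_algebra_def left_extend_unassoc clin flip: tensor_assoc_inject)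
    also have "tensor_map (\<lambda>y. 1 \<otimes> y) id (\<delta> b) = left_extend \<delta> (1 \<otimes> b)"
      by (simp add: left_extend_tensor clin)
    finally show "tensor_map can id (diagonal_coaction \<delta> (a \<otimes> b)) = left_extend \<delta> (can (a \<otimes> b))"
      by (simp only: E.coaction_mult can_tensor UNIV_I)
  qed
  thus ?thesis by (rule fun_cong)
qed

lemma clinear_diagonal [clin]: "clinear f \<Longrightarrow> clinear (\<lambda>x. diagonal_coaction \<delta> (f x))"
    "clinear (diagonal_coaction \<delta>)"
  unfolding diagonal_coaction_def by (intro clin; assumption?)+

sublocale B: right_comodule_algebra \<Delta> \<epsilon> UNIV "(\<bullet>)" "1 \<otimes> 1" "diagonal_coaction \<delta>"
  by (rule comodule_algebra_transport[OF linear_comult linear_counit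
      left_extend_comodule_algebra[OF linear_comult linear_counit R.right_comodule_algebra_axioms complex_algebra_on_UNIV],
      of can])
    (simp_all add: bij_can can_bmult can_diagonal L.coaction_unit clin)

lemma cbilinear_bmult: "cbilinear (\<bullet>)"
  using B.algebra by (simp add: complex_algebra_on_def)

lemma join_coaction_eq: "join_coaction \<delta> = left_extend (diagonal_coaction \<delta>)"
  by (simp add: join_coaction_def left_extend_def tensor_map_def)

lemma join_comodule_algebra_UNIV:
  "right_comodule_algebra \<Delta> \<epsilon> UNIV (join_mult \<gamma>) join_unit (join_coaction \<delta>)"
  unfolding join_coaction_eq join_mult_def join_unit_def
  by (rule left_extend_comodule_algebra[OF linear_comult linear_counit B.right_comodule_algebra_axioms complex_algebra_on_UNIV])

text \<open>Under \<open>can\<close> the second copy of A becomes 1 \<otimes> A; the first copy,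
  treated next, becomes \<gamma>(A). In both cases the embedding is multiplicative.\<close>

lemma bmult_left: "(1 \<otimes> x) \<bullet> (1 \<otimes> y) = 1 \<otimes> (x * y)"
  by (simp add: can_inject[symmetric] can_bmult tensor_mult_tensor cbilinear_times)

lemma bmult_right: "(x \<otimes> 1) \<bullet> (y \<otimes> 1) = (x * y) \<otimes> 1"
  by (simp add: can_inject[symmetric] can_bmult L.coaction_mult)

lemma diagonal_left: "diagonal_coaction \<delta> (1 \<otimes> x) = tensor_map (\<lambda>x. 1 \<otimes> x) id (\<delta> x)"
  unfolding diagonal_coaction_def tensor_map_def
  by (subst tensor_lift_tensor, intro clin) (simp add: R.coaction_unit tensor_lift_tensor clin)

lemma diagonal_right: "diagonal_coaction \<delta> (x \<otimes> 1) = tensor_map (\<lambda>x. x \<otimes> 1) id (\<delta> x)"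
  unfolding diagonal_coaction_def tensor_map_def
  by (subst tensor_lift_tensor, intro clin) (simp add: R.coaction_unit tensor_lift_tensor clin)

section \<open>The join as a subalgebra and a subcomodule\<close>

lemma join_carrier_iff:
  "x \<in> join_carrier \<longleftrightarrow> eval_at 0 x \<in> range (\<lambda>a::'a. 1 \<otimes> a) \<and> eval_at 1 x \<in> range (\<lambda>a::'a. a \<otimes> 1)"
  by (simp add: join_carrier_def tensor_sub_scalars_left tensor_sub_scalars_right)

lemma subspace_join_carrier: "cv.subspace (join_carrier :: (cont01 \<otimes> 'a \<otimes> 'a) set)"
proof -
  have *: "(join_carrier :: (cont01 \<otimes> 'a \<otimes> 'a) set) =
    eval_at 0 -` range (\<lambda>a::'a. 1 \<otimes> a) \<inter> eval_at 1 -` range (\<lambda>a::'a. a \<otimes> 1)"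
    by (auto simp: join_carrier_iff)
  show ?thesis
    by (subst *) (intro cv.subspace_inter subspace_vimage subspace_range clin clinear_eval_at[OF clinear_ident(1)])
qed

lemma join_unit_in: "join_unit \<in> (join_carrier :: (cont01 \<otimes> 'a \<otimes> 'a) set)"
  by (simp add: join_carrier_iff join_unit_def one_cont01.rep_eq)

text \<open>Evaluation at the end points is multiplicative, and the end fibres 1 \<otimes> A and A
  \<otimes> 1 are closed under the braided product.\<close>

lemma join_algebra: "complex_algebra_on join_carrier (join_mult \<gamma>) join_unit"
proof (rule complex_algebra_on_subset[OF right_comodule_algebra.algebra[OF join_comodule_algebra_UNIV]])
  show "join_mult \<gamma> x y \<in> join_carrier" if "x \<in> join_carrier" "y \<in> join_carrier" for x y
    using that unfolding join_carrier_iff join_mult_def eval_at_mult[OF cbilinear_bmult]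
    by (auto simp: bmult_left bmult_right)
qed (simp_all add: subspace_join_carrier join_unit_in)

lemma eval_at_join_coaction:
  "tensor_map (eval_at r) id (join_coaction \<delta> x) = diagonal_coaction \<delta> (eval_at r x)"
  unfolding join_coaction_eq eval_at_slice by (rule slice_left_extend) (simp_all add: clin clinear_ev)

text \<open>The laws restrict from the ambient space; what remains is closure. Slices on H commute
  with evaluation, and the diagonal coaction keeps each end fibre 1 \<otimes> A, A \<otimes> 1 in
  its place.\<close>

lemma join_comodule_algebra:
  "right_comodule_algebra \<Delta> \<epsilon> join_carrier (join_mult \<gamma>) join_unit (join_coaction \<delta>)"
proof (rule comodule_algebra_subset[OF linear_comult linear_counit join_comodule_algebra_UNIV join_algebra])
  fix p :: "cont01 \<otimes> 'a \<otimes> 'a" assume p: "p \<in> join_carrier"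
  show "join_coaction \<delta> p \<in> tensor_sub join_carrier UNIV"
  proof (rule tensor_sub_rightI)
    fix \<phi> :: "'h \<Rightarrow> complex" assume \<phi>: "clinear \<phi>"
    have "eval_at r (slice_right \<phi> (join_coaction \<delta> p)) = slice_right \<phi> (diagonal_coaction \<delta> (eval_at r p))" for r
      by (simp add: eval_at_join_coaction[symmetric] slice_right_map \<phi> clinear_eval_at[OF clinear_ident(1)])
    with p show "slice_right \<phi> (join_coaction \<delta> p) \<in> join_carrier"
      unfolding join_carrier_iff
      by (auto simp: diagonal_left diagonal_right slice_right_map \<phi> clin)
  qed
qed

end

section \<open>The translation map\<close>

lemma right_can_tensor:
  assumes "cbilinear m" "clinear \<delta>"
  shows "right_can m \<delta> (p \<otimes> q) = tensor_map (m p) id (\<delta> q)"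
  unfolding right_can_def tensor_map_def
  by (subst tensor_lift_tensor)
    (intro clin assms(2) clinear_comp[OF assms(2)] cbilinear_left[OF assms(1)] cbilinear_right[OF assms(1)], simp)

lemma clinear_right_can:
  assumes "cbilinear m" "clinear \<delta>"
  shows "clinear (right_can m \<delta>)"
  unfolding right_can_def
  by (intro clinear_tensor_lift clin assms(2) clinear_comp[OF assms(2)] cbilinear_left[OF assms(1)] cbilinear_right[OF assms(1)])

text \<open>The coordinate function of the interval; all coefficients of the strong connection are
  polynomials in it.\<close>

lift_definition ramp :: cont01 is "\<lambda>t. if t \<in> {0..1} then complex_of_real t else 0"
proof -
  have "continuous_on {0..1} (\<lambda>t. if t \<in> {0..1} then complex_of_real t else 0) =
      continuous_on {0..1} complex_of_real"
    by (intro continuous_on_cong) auto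
  thus "continuous_on {0..1} (\<lambda>t. if t \<in> {0..1} then complex_of_real t else 0) \<and>
      (\<forall>t. t \<notin> {0..1} \<longrightarrow> (if t \<in> {0..1} then complex_of_real t else 0) = 0)"
    by (auto intro: continuous_intros)
qed

lemma ev_ramp [simp]: "ev ramp 0 = 0" "ev ramp 1 = 1"
  by (simp_all add: ramp.rep_eq)

context bigalois
begin

abbreviation rcan where "rcan \<equiv> right_can (*) \<delta>"

lemmas rcan_tensor = right_can_tensor[OF cbilinear_times R.linear_coaction]

lemma clinear_rcan [clin]: "clinear rcan" "clinear f \<Longrightarrow> clinear (\<lambda>x. rcan (f x))"
  by (rule clinear_right_can[OF cbilinear_times R.linear_coaction]
    clinear_comp[OF clinear_right_can[OF cbilinear_times R.linear_coaction]], assumption?)+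

lemma clinear_comult [clin]: "clinear f \<Longrightarrow> clinear (\<lambda>x. \<Delta> (f x))" "clinear \<Delta>"
  by (rule linear_comult clinear_comp[OF linear_comult], assumption?)+

lemma clinear_antipode [clin]: "clinear f \<Longrightarrow> clinear (\<lambda>x. S (f x))" "clinear S"
  by (rule linear_antipode clinear_comp[OF linear_antipode], assumption?)+

lemma bij_rcan: "bij rcan" using right_galois by (simp add: right_galois_object_def)

text \<open>The translation map of the right Galois object. Together with
  \<open>rcan_translation\<close>, the facts proved below on its unit and its right and left
  colinearity make it a strong connection on A.\<close>

definition translation where "translation h = inv rcan (1 \<otimes> h)"

lemma rcan_translation [simp]: "rcan (translation h) = 1 \<otimes> h"
  unfolding translation_def using bij_rcan by (simp add: bij_is_surj surj_f_inv_f)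

lemma clinear_translation [clin]: "clinear translation" "clinear f \<Longrightarrow> clinear (\<lambda>x. translation (f x))"
proof -
  show *: "clinear translation"
    unfolding translation_def by (intro clinear_comp[OF clinear_inv[OF clinear_rcan(1) bij_rcan]] clin)
  show "clinear f \<Longrightarrow> clinear (\<lambda>x. translation (f x))" by (rule clinear_comp[OF *])
qed

lemma translation_one: "translation 1 = 1 \<otimes> 1"
proof -
  have "rcan (translation 1) = rcan (1 \<otimes> 1)"
    by (simp add: rcan_tensor R.coaction_unit clin)
  thus ?thesis using bij_rcan by (metis bij_is_inj injD)
qed

text \<open>Coassociativity of \<delta>, with the left factor p carried along: the canonical map
  intertwines \<delta> on the second copy of A with \<Delta> on H.\<close>

lemma rcan_colinear: "tensor_map rcan id (tensor_unassoc (tensor_map id \<delta> z)) = tensor_unassoc (tensor_map id \<Delta> (rcan z))"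
proof -
  have "(\<lambda>z. tensor_map rcan id (tensor_unassoc (tensor_map id \<delta> z))) =
      (\<lambda>z. tensor_unassoc (tensor_map id \<Delta> (rcan z)))"
  proof (rule tensor_ext, intro clin, intro clin)
    fix p q
    have "tensor_map rcan id (tensor_unassoc (tensor_map id \<delta> (p \<otimes> q))) =
        tensor_map (tensor_map ((*) p) id) id (tensor_map \<delta> id (\<delta> q))"
      by (simp add: tensor_unassoc_tensor tensor_map_comp rcan_tensor clin id_def)
    also have "\<dots> = tensor_unassoc (tensor_map ((*) p) (tensor_map id id) (tensor_assoc (tensor_map \<delta> id (\<delta> q))))"
      by (subst tensor_assoc_map[symmetric]) (simp_all add: clin)
    also have "\<dots> = tensor_unassoc (tensor_map id \<Delta> (rcan (p \<otimes> q)))"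
      by (simp add: R.coaction_coassoc[unfolded id_def] tensor_map_comp rcan_tensor clin id_def)
    finally show "tensor_map rcan id (tensor_unassoc (tensor_map id \<delta> (p \<otimes> q))) =
      tensor_unassoc (tensor_map id \<Delta> (rcan (p \<otimes> q)))" .
  qed
  thus ?thesis by (rule fun_cong)
qed

text \<open>After the injective map \<open>rcan\<close> \<otimes> id both sides become 1 \<otimes>
  \<Delta> h, up to bracketing.\<close>

lemma translation_right_colinear:
  "tensor_map id \<delta> (translation h) = tensor_assoc (tensor_map translation id (\<Delta> h))"
proof -
  have "tensor_map rcan id (tensor_unassoc (tensor_map id \<delta> (translation h))) =
      tensor_map rcan id (tensor_map translation id (\<Delta> h))"
    by (simp add: rcan_colinear[unfolded id_def] tensor_unassoc_tensor tensor_map_comp clin id_def)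
  hence "tensor_unassoc (tensor_map id \<delta> (translation h)) = tensor_map translation id (\<Delta> h)"
    using inj_tensor_map[OF clinear_rcan(1) bij_is_inj[OF bij_rcan] clinear_ident(2) inj_on_id]
    by (metis injD)
  thus ?thesis by (metis tensor_assoc_unassoc)
qed

text \<open>Left colinearity of the translation map is verified after applying \<open>S\<close> to the first leg: in this form
  \<open>q\<^sub>1 S(q\<^sub>2) = \<epsilon>(q\<^sub>1)\<close> suffices and the antimultiplicativity of \<open>S\<close> is not used.\<close>

definition contract :: "('a \<otimes> 'h) \<otimes> ('h \<otimes> 'h) \<Rightarrow> 'h \<otimes> 'a \<otimes> 'h" where
  "contract = tensor_lift (\<lambda>X Y. tensor_lift (\<lambda>a b. tensor_lift (\<lambda>c d. (b * S c) \<otimes> a \<otimes> d) Y) X)"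

lemma contract_tensor: "contract ((a \<otimes> b) \<otimes> (c \<otimes> d)) = (b * S c) \<otimes> a \<otimes> d"
  unfolding contract_def by (simp add: tensor_lift_tensor clin)

lemma clinear_contract [clin]: "clinear f \<Longrightarrow> clinear (\<lambda>x. contract (f x))"
  unfolding contract_def by (intro clin)

text \<open>In Sweedler legs the argument is q0 \<otimes> q1 \<otimes> q2 \<otimes> q3, which
  \<open>contract\<close> sends to q1 S(q2) \<otimes> q0 \<otimes> q3; the antipode and counit laws
  collapse the middle legs.\<close>

lemma contract_coaction: "contract (tensor_map \<delta> \<Delta> (\<delta> q)) = 1 \<otimes> \<delta> q"
proof -
  \<comment> \<open>N is \<open>contract\<close> with the last leg left off, so that only three legs
    have to be collapsed.\<close>
  define N :: "('a \<otimes> 'h) \<otimes> 'h \<Rightarrow> 'h \<otimes> 'a" where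
    "N = tensor_lift (\<lambda>X c. tensor_lift (\<lambda>a b. (b * S c) \<otimes> a) X)"
  have N [simp]: "N ((a \<otimes> b) \<otimes> c) = (b * S c) \<otimes> a" for a b c
    unfolding N_def by (simp add: tensor_lift_tensor clin)
  have linN: "clinear f \<Longrightarrow> clinear (\<lambda>x. N (f x))" for f :: "'x::complex_vector \<Rightarrow> _"
    unfolding N_def by (intro clin)
  have N_assoc: "contract (tensor_assoc (w \<otimes> k)) = tensor_assoc (N w \<otimes> k)" for w k
    by (rule fun_cong[OF tensor_ext3'], (intro clin linN)+) (simp add: contract_tensor)
  have N_comult: "N (tensor_unassoc (tensor_map id \<Delta> Y)) = 1 \<otimes> slice_right \<epsilon> Y" for Y
  proof -
    have *: "N (tensor_unassoc (a \<otimes> D)) = tensor_lift (\<lambda>a b. a * S b) D \<otimes> a" for a D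
      by (rule fun_cong[OF tensor_ext], (intro clin linN)+) (simp add: tensor_lift_tensor clin)
    show ?thesis
      by (rule fun_cong[OF tensor_ext], (intro clin linN linear_counit)+)
        (simp add: * antipode_right clin linear_counit tensor_scaleC_left tensor_scaleC_right)
  qed
  \<comment> \<open>Coassociativity trades the inner \<delta> for \<Delta> on H, where N reduces to
    the antipode law.\<close>
  have "N (tensor_map \<delta> id (\<delta> y)) = N (tensor_unassoc (tensor_map id \<Delta> (\<delta> y)))" for y
    by (subst R.coaction_coassoc[symmetric]) simp_all
  hence N_coaction: "N (tensor_map \<delta> id (\<delta> y)) = 1 \<otimes> y" for y
    using R.coaction_counit[of y] by (simp add: N_comult slice_right_def)
  have contract_assoc: "contract (tensor_assoc Z) = tensor_assoc (tensor_map N id Z)" for Z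
    by (rule fun_cong[OF tensor_ext], (intro clin linN clinear_ident(2) linN[OF clinear_ident(1)])+)
      (simp add: N_assoc linN[OF clinear_ident(1)] clin)
  \<comment> \<open>The four legs are regrouped as three applications of \<delta> on the A leg, so
    that N meets the first three.\<close>
  have "tensor_map \<delta> \<Delta> (\<delta> q) = tensor_map \<delta> (tensor_map id id) (tensor_map id \<Delta> (\<delta> q))"
    by (simp add: tensor_map_comp clin id_def)
  also have "\<dots> = tensor_map \<delta> (tensor_map id id) (tensor_assoc (tensor_map \<delta> id (\<delta> q)))"
    by (simp add: R.coaction_coassoc)
  also have "\<dots> = tensor_assoc (tensor_map (tensor_map \<delta> id) id (tensor_map \<delta> id (\<delta> q)))"
    by (rule tensor_assoc_map[symmetric]) (simp_all add: clin)
  also have "contract \<dots> = tensor_assoc (tensor_map (\<lambda>y. 1 \<otimes> y) id (\<delta> q))"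
    by (simp add: contract_assoc tensor_map_comp linN N_coaction[unfolded id_def] clin id_def)
  also have "\<dots> = 1 \<otimes> \<delta> q"
    by (simp flip: tensor_unassoc_tensor)
  finally show ?thesis .
qed

text \<open>On p \<otimes> q the left side is p1 q1 S(q2) \<otimes> p0 q0 \<otimes> q3. The antipode
  removes the middle legs of q and leaves p1 \<otimes> p0 q0 \<otimes> q1, which is p1 \<otimes>
  rcan(p0 \<otimes> q).\<close>

lemma rcan_left_coaction:
  "contract (tensor_map \<delta> \<Delta> (rcan z)) =
    tensor_map id rcan (tensor_assoc (tensor_map (\<lambda>p. tensor_flip (\<delta> p)) id z))"
proof -
  note bt = cbilinear_tensor_mult[OF cbilinear_times cbilinear_times]
  have "(\<lambda>z. contract (tensor_map \<delta> \<Delta> (rcan z))) =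
    (\<lambda>z. tensor_map id rcan (tensor_assoc (tensor_map (\<lambda>p. tensor_flip (\<delta> p)) id z)))"
  proof (rule tensor_ext, intro clin, intro clin)
    fix p q
    let ?V = "tensor_map \<delta> \<Delta> (\<delta> q)"
    \<comment> \<open>The first two output legs of \<open>contract\<close> carry left factors only,
      so a left factor x \<otimes> g can be pulled out before \<open>contract_coaction\<close> is
      used.\<close>
    have pure: "contract (tensor_map (tensor_mult (*) (*) (x \<otimes> g)) id V) =
        tensor_map ((*) g) (tensor_map ((*) x) id) (contract V)" for x g V
    proof -
      let ?f = "\<lambda>V. contract (tensor_map (tensor_mult (*) (*) (x \<otimes> g)) id V)"
      let ?g = "\<lambda>V. tensor_map ((*) g) (tensor_map ((*) x) id) (contract V)"
      have "(\<lambda>w. ?f (w \<otimes> (c \<otimes> d))) = (\<lambda>w. ?g (w \<otimes> (c \<otimes> d)))" for c d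
        by (rule tensor_ext, (intro clin cbilinear_right[OF bt])+)
          (simp add: contract_tensor tensor_mult_tensor cbilinear_times cbilinear_right[OF bt] bt mult.assoc clin)
      hence "?f = ?g"
        by (intro tensor_ext3 clin cbilinear_right[OF bt]) (rule fun_cong)
      thus ?thesis by (rule fun_cong)
    qed
    \<comment> \<open>Linearity replaces the pure x \<otimes> g by an arbitrary X, to be
      instantiated with \<delta> p.\<close>
    have gen: "contract (tensor_map (tensor_mult (*) (*) X) id ?V) =
        tensor_map id (\<lambda>y. rcan (y \<otimes> q)) (tensor_flip X)" for X
    proof -
      have "(\<lambda>X. contract (tensor_map (tensor_mult (*) (*) X) id ?V)) =
          (\<lambda>X. tensor_map id (\<lambda>y. rcan (y \<otimes> q)) (tensor_flip X))"
        by (rule tensor_ext, (intro clin cbilinear_right[OF bt] cbilinear_left[OF bt])+)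
          (simp add: pure contract_coaction rcan_tensor clin)
      thus ?thesis by (rule fun_cong)
    qed
    have "tensor_map \<delta> \<Delta> (rcan (p \<otimes> q)) = tensor_map (tensor_mult (*) (*) (\<delta> p)) id ?V"
      by (simp add: rcan_tensor tensor_map_comp R.coaction_mult cbilinear_right[OF bt] clin id_def)
    moreover have "tensor_assoc (X \<otimes> q) = tensor_map id (\<lambda>y. y \<otimes> q) X" for X :: "'h \<otimes> 'a"
      by (rule fun_cong[OF tensor_ext], (intro clin)+) (simp add: clin)
    ultimately show "contract (tensor_map \<delta> \<Delta> (rcan (p \<otimes> q))) =
      tensor_map id rcan (tensor_assoc (tensor_map (\<lambda>p. tensor_flip (\<delta> p)) id (p \<otimes> q)))"
      by (simp add: gen[unfolded id_def] tensor_map_comp clin id_def)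
  qed
  thus ?thesis by (rule fun_cong)
qed

lemma clinear_inv_S [clin]: "clinear (inv S)" "clinear f \<Longrightarrow> clinear (\<lambda>x. inv S (f x))"
  by (rule clinear_inv[OF linear_antipode bij_S] clinear_comp[OF clinear_inv[OF linear_antipode bij_S]], assumption?)+

text \<open>The two sides are compared after the injective maps S \<otimes> id and id \<otimes>
  \<open>rcan\<close>. Then S cancels \<open>inv S\<close>, and \<open>rcan_left_coaction\<close>
  evaluates the left side, through rcan(translation h) = 1 \<otimes> h, to S(h1) \<otimes> 1
  \<otimes> h2.\<close>

lemma translation_left_colinear:
  "tensor_assoc (tensor_map (\<lambda>p. tensor_map (inv S) id (tensor_flip (\<delta> p))) id (translation h)) =
    tensor_map id translation (\<Delta> h)" (is "?l = ?r")
proof -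
  have [simp]: "S (inv S x) = x" for x using bij_S by (simp add: bij_is_surj surj_f_inv_f)
  have "tensor_map id rcan (tensor_map S id ?l) =
      tensor_map id rcan (tensor_assoc (tensor_map (tensor_map S id) id
        (tensor_map (\<lambda>p. tensor_map (inv S) id (tensor_flip (\<delta> p))) id (translation h))))"
    by (subst tensor_assoc_map) (simp_all add: clin id_def)
  also have "\<dots> = tensor_map id rcan (tensor_assoc (tensor_map (\<lambda>p. tensor_flip (\<delta> p)) id (translation h)))"
    by (simp add: tensor_map_comp clin id_def)
  also have "\<dots> = contract (tensor_map \<delta> \<Delta> (1 \<otimes> h))"
    by (simp flip: rcan_left_coaction)
  also have "\<dots> = tensor_map S (\<lambda>y. 1 \<otimes> y) (\<Delta> h)"
  proof -
    have "contract ((1 \<otimes> 1) \<otimes> Y) = tensor_map S (\<lambda>y. 1 \<otimes> y) Y" for Y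
      by (rule fun_cong[OF tensor_ext], (intro clin)+) (simp add: contract_tensor clin)
    thus ?thesis by (simp add: R.coaction_unit clin)
  qed
  also have "\<dots> = tensor_map id rcan (tensor_map S id ?r)"
    by (simp add: tensor_map_comp clin id_def)
  finally have "tensor_map S id ?l = tensor_map S id ?r"
    using inj_tensor_map[OF clinear_ident(2) inj_on_id clinear_rcan(1) bij_is_inj[OF bij_rcan]]
    by (metis injD)
  thus ?thesis
    using inj_tensor_map[OF linear_antipode bij_is_inj[OF bij_S] clinear_ident(2) inj_on_id]
    by (metis injD)
qed

end

section \<open>The strong connection and the coinvariants\<close>

text \<open>The natural map runs from the suspension into the join, against the direction in
  \<open>algebra_isomorphic\<close>, so the witness is its inverse.\<close>

lemma algebra_isomorphicI:
  assumes "complex_algebra_on P m u" "complex_algebra_on Q n v"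
    and \<Psi>: "clinear \<Psi>" "inj \<Psi>" "\<Psi> ` Q = P" "\<Psi> v = u" "\<And>x y. \<Psi> (n x y) = m (\<Psi> x) (\<Psi> y)"
  shows "algebra_isomorphic P m u Q n v"
  unfolding algebra_isomorphic_def
proof (intro conjI assms(1,2) exI[of _ "inv \<Psi>"] ballI allI)
  have inv: "inv \<Psi> (\<Psi> x) = x" for x using \<Psi>(2) by (rule inv_f_f)
  show "bij_betw (inv \<Psi>) P Q"
    by (rule bij_betw_byWitness[where f' = \<Psi>]) (use \<Psi>(3) inv in auto)
  show "inv \<Psi> u = v" using inv \<Psi>(4) by metis
  fix x y c assume "x \<in> P"
  then obtain x' where x: "x = \<Psi> x'" using \<Psi>(3) by blast
  show "inv \<Psi> (c *\<^sub>C x) = c *\<^sub>C inv \<Psi> x"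
    using \<Psi>(1) inv unfolding x clinear_iff by metis
  assume "y \<in> P"
  then obtain y' where y: "y = \<Psi> y'" using \<Psi>(3) by blast
  show "inv \<Psi> (x + y) = inv \<Psi> x + inv \<Psi> y"
    using \<Psi>(1) inv unfolding x y clinear_iff by metis
  show "inv \<Psi> (m x y) = n (inv \<Psi> x) (inv \<Psi> y)"
    using \<Psi>(5) inv unfolding x y by metis
qed

lemma unreduced_suspension_algebra:
  "complex_algebra_on (unreduced_suspension :: (cont01 \<otimes> 'h::complex_algebra_1) set) (tensor_mult (*) (*)) (1 \<otimes> 1)"
proof (rule complex_algebra_on_subset[OF tensor_mult_algebra[OF complex_algebra_on_UNIV complex_algebra_on_UNIV]])
  have "unreduced_suspension = eval_at 0 -` scalars \<inter> eval_at 1 -` (scalars :: 'h set)"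
    by (auto simp: unreduced_suspension_def)
  thus "cv.subspace (unreduced_suspension :: (cont01 \<otimes> 'h) set)"
    using cv.subspace_inter subspace_vimage[OF clinear_eval_at[OF clinear_ident(1)] subspace_scalars] by metis
  have one: "(1 :: 'h) \<in> scalars" unfolding scalars_def by (metis scaleC_one rangeI)
  thus "1 \<otimes> 1 \<in> (unreduced_suspension :: (cont01 \<otimes> 'h) set)"
    by (simp add: unreduced_suspension_def one_cont01.rep_eq)
  have "a * b \<in> scalars" if "a \<in> scalars" "b \<in> scalars" for a b :: 'h
    using that unfolding scalars_def by auto
  thus "tensor_mult (*) (*) x y \<in> unreduced_suspension"
    if "x \<in> unreduced_suspension" "y \<in> unreduced_suspension" for x y :: "cont01 \<otimes> 'h"
    using that by (simp add: unreduced_suspension_def eval_at_mult cbilinear_times)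
qed simp_all

section \<open>Colinear maps from A into the join, and the strong connection\<close>

context bigalois
begin

definition edge :: "cont01 \<Rightarrow> cont01 \<Rightarrow> 'a \<Rightarrow> cont01 \<otimes> 'a \<otimes> 'a" where
  "edge f g x = f \<otimes> 1 \<otimes> x + g \<otimes> x \<otimes> 1"

lemma clinear_edge [clin]: "clinear (edge f g)" "clinear k \<Longrightarrow> clinear (\<lambda>x. edge f g (k x))"
  unfolding edge_def[abs_def] by (intro clin; assumption)+

text \<open>At 0 only a multiple of 1 \<otimes> x survives, at 1 only a multiple of x \<otimes>
  1.\<close>

lemma edge_in_join_carrier: "ev f 1 = 0 \<Longrightarrow> ev g 0 = 0 \<Longrightarrow> edge f g x \<in> join_carrier"
proof -
  have "c *\<^sub>C ((1::'a) \<otimes> x) \<in> range (\<lambda>a. 1 \<otimes> a)" "c *\<^sub>C (x \<otimes> (1::'a)) \<in> range (\<lambda>a. a \<otimes> 1)" for c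
    by (metis tensor_scaleC_right rangeI) (metis tensor_scaleC_left rangeI)
  thus "ev f 1 = 0 \<Longrightarrow> ev g 0 = 0 \<Longrightarrow> edge f g x \<in> join_carrier"
    by (simp add: join_carrier_iff edge_def clinear_eval_at[OF clinear_ident(1), unfolded clinear_iff])
qed

lemma edge_one: "edge f g 1 = (f + g) \<otimes> 1 \<otimes> 1"
  by (simp add: edge_def tensor_add_left)

lemma clinear_join_coaction [clin]: "clinear (join_coaction \<delta>)"
  "clinear f \<Longrightarrow> clinear (\<lambda>x. join_coaction \<delta> (f x))"
  unfolding join_coaction_eq by (intro clin; assumption)+

text \<open>Both embeddings of A are colinear, and the coaction ignores the function leg.
  Colinearity of the translation map therefore passes to its images under edge maps.\<close>

lemma join_coaction_edge: "join_coaction \<delta> (edge f g x) = tensor_map (edge f g) id (\<delta> x)"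
proof -
  have "join_coaction \<delta> (edge f g x) = join_coaction \<delta> (f \<otimes> 1 \<otimes> x) + join_coaction \<delta> (g \<otimes> x \<otimes> 1)"
    using clinear_join_coaction(1) by (simp add: edge_def clinear_iff)
  also have "\<dots> = tensor_map (\<lambda>x. f \<otimes> 1 \<otimes> x + g \<otimes> x \<otimes> 1) id (\<delta> x)"
    by (simp add: join_coaction_eq left_extend_tensor diagonal_left diagonal_right tensor_map_comp
        tensor_map_add_left clin id_def)
  finally show ?thesis by (simp add: edge_def[abs_def])
qed

lemma cbilinear_join_mult: "cbilinear (join_mult \<gamma>)"
  unfolding join_mult_def by (rule cbilinear_tensor_mult[OF cbilinear_times cbilinear_bmult])

text \<open>The pure terms multiply as in A. The mixed terms involve the braiding and are left as
  they stand, to be cancelled through their coefficients.\<close>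

lemma join_mult_edge:
  "join_mult \<gamma> (edge f g x) (edge f' g' y) = edge (f * f') (g * g') (x * y) +
    (f * g') \<otimes> ((1 \<otimes> x) \<bullet> (y \<otimes> 1)) + (g * f') \<otimes> ((x \<otimes> 1) \<bullet> (1 \<otimes> y))"
  unfolding edge_def cbilinear_add_left[OF cbilinear_join_mult] cbilinear_add_right[OF cbilinear_join_mult]
  by (simp add: join_mult_def tensor_mult_tensor cbilinear_times cbilinear_bmult bmult_left bmult_right)

text \<open>Modulo the canonical map, a sum of pairs \<open>(edge f\<^sub>i g\<^sub>i, edge f'\<^sub>i g'\<^sub>i)\<close> applied to the translation map is
  \<open>1 \<otimes> h\<close> as soon as \<open>\<Sum> f\<^sub>i g'\<^sub>i = \<Sum> g\<^sub>i f'\<^sub>i = 0\<close> and \<open>\<Sum> (f\<^sub>i f'\<^sub>i + g\<^sub>i g'\<^sub>i) = 1\<close> in \<open>C([0,1])\<close>. The first pair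
  alone is the linear interpolation between the two ends; it is unital, and the other two, which vanish at
  \<open>h = 1\<close>, cancel its mixed terms.\<close>

definition connection :: "'h \<Rightarrow> (cont01 \<otimes> 'a \<otimes> 'a) \<otimes> (cont01 \<otimes> 'a \<otimes> 'a)" where
  "connection h = (let c = ramp; a = 1 - c; b = a * c in
     tensor_map (edge a c) (edge a c) (translation h) +
     tensor_map (edge b (- b)) (edge a (- c)) (translation h) +
     tensor_map (edge a (- c)) (edge b (- b)) (translation h))"

text \<open>Valid for arbitrary coefficients, as edge maps are colinear; the choice of coefficients
  matters only for the carrier, the unit and the canonical map.\<close>

lemma edges_right_colinear:
  "tensor_map id (join_coaction \<delta>) (tensor_map (edge f g) (edge f' g') (translation h)) =
    tensor_assoc (tensor_map (\<lambda>h. tensor_map (edge f g) (edge f' g') (translation h)) id (\<Delta> h))"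
proof -
  have "tensor_map id (join_coaction \<delta>) (tensor_map (edge f g) (edge f' g') (translation h)) =
      tensor_map (edge f g) (tensor_map (edge f' g') id) (tensor_map id \<delta> (translation h))"
    by (simp add: tensor_map_comp join_coaction_edge[unfolded id_def] clin id_def)
  also have "\<dots> = tensor_assoc (tensor_map (tensor_map (edge f g) (edge f' g')) id (tensor_map translation id (\<Delta> h)))"
    by (simp add: translation_right_colinear tensor_assoc_map clin)
  finally show ?thesis by (simp add: tensor_map_comp clin id_def)
qed

lemma edges_left_colinear:
  "tensor_assoc (tensor_map (\<lambda>p. tensor_map (inv S) id (tensor_flip (join_coaction \<delta> p))) id
      (tensor_map (edge f g) (edge f' g') (translation h))) =
    tensor_map id (\<lambda>h. tensor_map (edge f g) (edge f' g') (translation h)) (\<Delta> h)"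
proof -
  have flip: "tensor_flip (tensor_map (edge f g) id X) = tensor_map id (edge f g) (tensor_flip X)" for X :: "'a \<otimes> 'h"
    by (rule fun_cong[OF tensor_ext], (intro clin)+) (simp add: clin)
  have "tensor_map (\<lambda>p. tensor_map (inv S) id (tensor_flip (join_coaction \<delta> p))) id
      (tensor_map (edge f g) (edge f' g') (translation h)) =
      tensor_map (tensor_map id (edge f g)) (edge f' g')
        (tensor_map (\<lambda>p. tensor_map (inv S) id (tensor_flip (\<delta> p))) id (translation h))"
    by (simp add: tensor_map_comp join_coaction_edge[unfolded id_def] flip[unfolded id_def] clin id_def)
  thus ?thesis
    by (simp only: tensor_assoc_map clin translation_left_colinear) (simp add: tensor_map_comp clin id_def)
qed

lemma edges_can:
  "right_can (join_mult \<gamma>) (join_coaction \<delta>) (tensor_map (edge f g) (edge f' g') (p \<otimes> q)) =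
    tensor_map (\<lambda>y. join_mult \<gamma> (edge f g p) (edge f' g' y)) id (\<delta> q)"
  by (simp add: right_can_tensor cbilinear_join_mult join_coaction_edge tensor_map_comp
      cbilinear_right[OF cbilinear_join_mult] clin id_def)

lemma strong_connection_connection:
  "strong_connection \<Delta> S join_carrier (join_mult \<gamma>) join_unit (join_coaction \<delta>) connection"
proof -
  define c where "c = ramp"
  define a where "a = 1 - c"
  define b where "b = a * c"
  have conn: "connection = (\<lambda>h. tensor_map (edge a c) (edge a c) (translation h) +
     tensor_map (edge b (- b)) (edge a (- c)) (translation h) +
     tensor_map (edge a (- c)) (edge b (- b)) (translation h))"
    by (simp add: fun_eq_iff connection_def Let_def a_def b_def c_def)
  have ev: "ev a 1 = 0" "ev c 0 = 0" "ev (- c) 0 = 0" "ev b 1 = 0" "ev (- b) 0 = 0"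
    by (simp_all add: a_def b_def c_def minus_cont01.rep_eq one_cont01.rep_eq times_cont01.rep_eq uminus_cont01.rep_eq)
  let ?can = "right_can (join_mult \<gamma>) (join_coaction \<delta>)"
  \<comment> \<open>The coefficients are the sums of \<open>f * f'\<close> and of
    \<open>g * g'\<close> over the three pairs.\<close>
  define \<xi> where "\<xi> = edge (a * a + b * a + a * b) (c * c + b * c + c * b)"
  \<comment> \<open>All three identities follow from a + c = 1 and b = a c: both mixed sums equal a
    c - b (a + c), and the diagonal sums add up to (a + c) squared.\<close>
  have cross: "a * c + b * (- c) + a * (- b) = 0" "c * a + (- b) * a + (- c) * b = 0"
    and one: "(a * a + b * a + a * b) + (c * c + b * c + c * b) = 1"
    by (simp_all add: b_def a_def algebra_simps)
  \<comment> \<open>With the mixed terms gone, the canonical map of the join on the connection is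
    that of A followed by \<xi>; as \<xi> sends 1 to the unit, 1 \<otimes> h becomes
    \<open>join_unit\<close> \<otimes> h.\<close>
  have can: "?can (connection h) = tensor_map \<xi> id (rcan (translation h))" for h
  proof -
    have lin: "clinear f \<Longrightarrow> clinear (\<lambda>x. ?can (f x))" for f :: "'a \<otimes> 'a \<Rightarrow> _"
      by (rule clinear_comp[OF clinear_right_can]) (simp_all add: cbilinear_join_mult clin)
    have add: "?can (x + y) = ?can x + ?can y" for x y
      using clinear_right_can[OF cbilinear_join_mult clinear_join_coaction(1)] by (simp add: clinear_iff)
    have mult: "join_mult \<gamma> (edge a c p) (edge a c y) + join_mult \<gamma> (edge b (- b) p) (edge a (- c) y) +
        join_mult \<gamma> (edge a (- c) p) (edge b (- b) y) = \<xi> (p * y)" for p y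
    proof -
      let ?X = "(1 \<otimes> p) \<bullet> (y \<otimes> 1)" and ?Y = "(p \<otimes> 1) \<bullet> (1 \<otimes> y)"
      have "join_mult \<gamma> (edge a c p) (edge a c y) + join_mult \<gamma> (edge b (- b) p) (edge a (- c) y) +
        join_mult \<gamma> (edge a (- c) p) (edge b (- b) y) = \<xi> (p * y) +
        (a * c + b * (- c) + a * (- b)) \<otimes> ?X + (c * a + (- b) * a + (- c) * b) \<otimes> ?Y"
        unfolding join_mult_edge \<xi>_def unfolding edge_def tensor_add_left by (simp add: algebra_simps)
      thus ?thesis unfolding cross by simp
    qed
    have "(\<lambda>z. ?can (tensor_map (edge a c) (edge a c) z + tensor_map (edge b (- b)) (edge a (- c)) z +
       tensor_map (edge a (- c)) (edge b (- b)) z)) = (\<lambda>z. tensor_map \<xi> id (rcan z))"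
    proof (rule tensor_ext, unfold \<xi>_def, intro lin clin, intro clin, fold \<xi>_def)
      fix p q
      show "?can (tensor_map (edge a c) (edge a c) (p \<otimes> q) + tensor_map (edge b (- b)) (edge a (- c)) (p \<otimes> q) +
         tensor_map (edge a (- c)) (edge b (- b)) (p \<otimes> q)) = tensor_map \<xi> id (rcan (p \<otimes> q))"
        unfolding add edges_can
        by (simp add: \<xi>_def rcan_tensor tensor_map_comp cbilinear_right[OF cbilinear_join_mult] clin
            mult[unfolded \<xi>_def] id_def flip: tensor_map_add_left)
    qed
    thus ?thesis unfolding conn by (rule fun_cong)
  qed
  show ?thesis
    unfolding strong_connection_def Let_def
  proof (intro conjI allI)
    show "clinear connection" unfolding conn by (intro clin)
    show "connection h \<in> tensor_sub join_carrier join_carrier" for h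
      unfolding conn
      by (intro cv.subspace_add[OF subspace_tensor_sub] tensor_map_in_tensor_sub clin edge_in_join_carrier ev)
    \<comment> \<open>At h = 1 the last two summands vanish, because \<open>edge b (- b) 1\<close>
      has coefficient b - b = 0.\<close>
    show "connection 1 = join_unit \<otimes> join_unit"
      by (simp add: conn translation_one edge_one join_unit_def clin a_def)
    show "tensor_map id (join_coaction \<delta>) (connection h) = tensor_assoc (tensor_map connection id (\<Delta> h))" for h
    proof -
      have "tensor_map id (join_coaction \<delta>) (x + y) = tensor_map id (join_coaction \<delta>) x + tensor_map id (join_coaction \<delta>) y"
        "tensor_assoc (u + v) = tensor_assoc u + tensor_assoc v"
        for x y :: "(cont01 \<otimes> 'a \<otimes> 'a) \<otimes> cont01 \<otimes> 'a \<otimes> 'a" and u v :: "((cont01 \<otimes> 'a \<otimes> 'a) \<otimes> (cont01 \<otimes> 'a \<otimes> 'a)) \<otimes> 'h"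
        by (rule clinear_add, intro clin)+
      thus ?thesis
        unfolding conn by (simp add: edges_right_colinear tensor_map_add_left clin)
    qed
    show "tensor_assoc (tensor_map (\<lambda>p. tensor_map (inv S) id (tensor_flip (join_coaction \<delta> p))) id (connection h)) =
        tensor_map id connection (\<Delta> h)" for h
    proof -
      let ?l = "\<lambda>z :: (cont01 \<otimes> 'a \<otimes> 'a) \<otimes> cont01 \<otimes> 'a \<otimes> 'a. tensor_assoc (tensor_map (\<lambda>p. tensor_map (inv S) id (tensor_flip (join_coaction \<delta> p))) id z)"
      have "clinear ?l" by (intro clin)
      hence "?l (x + y) = ?l x + ?l y" for x y by (rule clinear_add)
      thus ?thesis
        unfolding conn by (simp add: edges_left_colinear tensor_map_add_right clin)
    qed
    show "?can (connection h) = join_unit \<otimes> h" for h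
      by (simp add: can \<xi>_def clin edge_one one join_unit_def)
  qed
qed

section \<open>Coinvariants of the braided product and of the join\<close>

definition coinvariant_embedding :: "'h \<Rightarrow> 'a \<otimes> 'a" where "coinvariant_embedding h = inv can (h \<otimes> 1)"

lemma can_coinvariant_embedding [simp]: "can (coinvariant_embedding h) = h \<otimes> 1"
  by (simp add: coinvariant_embedding_def)

lemma clinear_coinvariant_embedding: "clinear coinvariant_embedding"
  unfolding coinvariant_embedding_def by (intro clinear_comp[OF clinear_inv[OF clinear_can(2) bij_can]] clin)

text \<open>As 1 is nonzero in A, the inclusion of the scalars splits. Applied to the second leg,
  such a functional recovers h from h \<otimes> 1.\<close>

lemma unital_functional: obtains \<psi> :: "'a \<Rightarrow> complex" where "clinear \<psi>" "\<psi> 1 = 1"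
proof -
  have "clinear (\<lambda>c. c *\<^sub>C (1::'a))" by (intro clin)
  moreover have "inj (\<lambda>c. c *\<^sub>C (1::'a))" by (simp add: inj_on_def)
  ultimately obtain \<psi> where "clinear \<psi>" "\<And>c. \<psi> (c *\<^sub>C (1::'a)) = c"
    by (rule clinear_left_inverse) blast
  thus thesis using that by (metis scaleC_one)
qed

lemma inj_coinvariant_embedding: "inj coinvariant_embedding"
proof -
  obtain \<psi> :: "'a \<Rightarrow> complex" where "clinear \<psi>" "\<psi> 1 = 1" by (rule unital_functional)
  hence "slice_right \<psi> (can (coinvariant_embedding h)) = h" for h by simp
  thus ?thesis by (metis injI)
qed

lemma coinvariant_embedding_one: "coinvariant_embedding 1 = 1 \<otimes> 1"
  by (simp add: can_inject[symmetric] L.coaction_unit)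

lemma coinvariant_embedding_mult: "coinvariant_embedding (h * k) = coinvariant_embedding h \<bullet> coinvariant_embedding k"
  by (simp add: can_inject[symmetric] can_bmult tensor_mult_tensor cbilinear_times)

lemma tensor_map_can_inject: "tensor_map can id x = tensor_map can id y \<longleftrightarrow> x = y"
  for x y :: "('a \<otimes> 'a) \<otimes> 'h"
  using inj_tensor_map[OF clinear_can(2) bij_is_inj[OF bij_can] clinear_ident(2) inj_on_id] by (metis injD)

lemma diagonal_coinvariant_embedding: "diagonal_coaction \<delta> (coinvariant_embedding h) = coinvariant_embedding h \<otimes> 1"
  by (simp add: tensor_map_can_inject[symmetric] can_diagonal left_extend_tensor R.coaction_unit clin)

text \<open>Under \<open>can\<close> the diagonal coaction is id \<otimes> \<delta> on H \<otimes>
  A, whose coinvariants lie in H \<otimes> \<complex> because the coinvariants of A are the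
  scalars.\<close>

lemma diagonal_coinvariants: "right_coinvariants UNIV (diagonal_coaction \<delta>) \<subseteq> range coinvariant_embedding"
proof
  fix y assume "y \<in> right_coinvariants UNIV (diagonal_coaction \<delta>)"
  hence "left_extend \<delta> (can y) = can y \<otimes> 1"
    by (simp add: right_coinvariants_def clin flip: can_diagonal)
  hence "can y \<in> tensor_sub UNIV (right_coinvariants UNIV \<delta>)"
    by (intro left_extend_coinvariant R.linear_coaction)
  also have "right_coinvariants UNIV \<delta> = scalars"
    using right_galois by (simp add: right_galois_object_def)
  finally obtain h where "can y = h \<otimes> 1" by (auto simp: tensor_sub_scalars_right)
  hence "y = coinvariant_embedding h" by (simp add: can_inject[symmetric])
  thus "y \<in> range coinvariant_embedding" by simp
qed

text \<open>The slice argument is used a second time, now with C([0,1]) as the inert leg and the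
  diagonal coaction on the other.\<close>

lemma join_coinvariants_UNIV: "join_coaction \<delta> x = x \<otimes> 1 \<longleftrightarrow> x \<in> range (tensor_map id coinvariant_embedding)"
proof
  assume "join_coaction \<delta> x = x \<otimes> 1"
  hence "x \<in> tensor_sub UNIV (right_coinvariants UNIV (diagonal_coaction \<delta>))"
    unfolding join_coaction_eq by (intro left_extend_coinvariant clin)
  also have "\<dots> \<subseteq> range (tensor_map id coinvariant_embedding)"
  proof (rule tensor_sub_subset)
    show "cv.subspace (range (tensor_map id coinvariant_embedding))"
      by (rule subspace_range) (intro clinear_tensor_map[OF clinear_ident(2) clinear_coinvariant_embedding clinear_ident(1)])
    fix f y assume "y \<in> right_coinvariants UNIV (diagonal_coaction \<delta>)"
    then obtain h where "y = coinvariant_embedding h" using diagonal_coinvariants by blast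
    hence "f \<otimes> y = tensor_map id coinvariant_embedding (f \<otimes> h)" by (simp add: clinear_coinvariant_embedding clin)
    thus "f \<otimes> y \<in> range (tensor_map id coinvariant_embedding)" by simp
  qed
  finally show "x \<in> range (tensor_map id coinvariant_embedding)" .
next
  have "(\<lambda>z. join_coaction \<delta> (tensor_map id coinvariant_embedding z)) = (\<lambda>z. tensor_map id coinvariant_embedding z \<otimes> 1)"
    by (rule tensor_ext, (intro clin clinear_coinvariant_embedding)+)
      (simp add: join_coaction_eq left_extend_tensor diagonal_coinvariant_embedding clinear_coinvariant_embedding clin)
  thus "x \<in> range (tensor_map id coinvariant_embedding) \<Longrightarrow> join_coaction \<delta> x = x \<otimes> 1"
    by (auto dest: fun_cong)
qed

text \<open>As \<open>can\<close> fixes 1 \<otimes> a, the left condition reads h \<otimes> 1 = 1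
  \<otimes> a, and a unital functional on A shows h to be a scalar.\<close>

lemma coinvariant_embedding_range_left: "coinvariant_embedding h \<in> range (\<lambda>a. 1 \<otimes> a) \<longleftrightarrow> h \<in> scalars"
proof
  assume "coinvariant_embedding h \<in> range (\<lambda>a. 1 \<otimes> a)"
  then obtain a where "coinvariant_embedding h = 1 \<otimes> a" by blast
  hence eq: "h \<otimes> 1 = 1 \<otimes> a" by (metis can_coinvariant_embedding can_left)
  obtain \<psi> :: "'a \<Rightarrow> complex" where "clinear \<psi>" "\<psi> 1 = 1" by (rule unital_functional)
  with arg_cong[OF eq, of "slice_right \<psi>"] have "h = \<psi> a *\<^sub>C 1" by simp
  thus "h \<in> scalars" by (simp add: scalars_def)
next
  assume "h \<in> scalars"
  then obtain c where "h = c *\<^sub>C 1" by (auto simp: scalars_def)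
  hence "coinvariant_embedding h = 1 \<otimes> (c *\<^sub>C 1)"
    by (simp add: can_inject[symmetric] tensor_scaleC_left tensor_scaleC_right
        clinear_can(2)[unfolded clinear_iff] L.coaction_unit)
  thus "coinvariant_embedding h \<in> range (\<lambda>a. 1 \<otimes> a)" by blast
qed

text \<open>If the value is a \<otimes> 1, its coinvariance makes a coinvariant under \<delta>,
  hence a scalar by the right Galois property; the scalar moves to the other leg and the previous
  lemma applies.\<close>

lemma coinvariant_embedding_range_right: "coinvariant_embedding h \<in> range (\<lambda>a. a \<otimes> 1) \<longleftrightarrow> h \<in> scalars"
proof
  assume "coinvariant_embedding h \<in> range (\<lambda>a. a \<otimes> 1)"
  then obtain a where a: "coinvariant_embedding h = a \<otimes> 1" by blast
  have "tensor_map (\<lambda>x. x \<otimes> 1) id (\<delta> a) = tensor_map (\<lambda>x::'a. x \<otimes> (1::'a)) id (a \<otimes> 1)"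
    using diagonal_coinvariant_embedding[of h] by (simp add: a diagonal_right clin)
  moreover have "inj (\<lambda>x::'a. x \<otimes> (1::'a))"
  proof -
    obtain \<psi> :: "'a \<Rightarrow> complex" where "clinear \<psi>" "\<psi> 1 = 1" by (rule unital_functional)
    hence "slice_right \<psi> (x \<otimes> 1) = x" for x :: 'a by simp
    thus ?thesis by (metis injI)
  qed
  hence "inj (tensor_map (\<lambda>x::'a. x \<otimes> (1::'a)) (id :: 'h \<Rightarrow> 'h))"
    by (intro inj_tensor_map clin inj_on_id)
  ultimately have "\<delta> a = a \<otimes> 1" by (metis injD)
  hence "a \<in> scalars"
    using right_galois by (auto simp: right_galois_object_def right_coinvariants_def)
  then obtain c where "a = c *\<^sub>C 1" by (auto simp: scalars_def)
  hence "coinvariant_embedding h = 1 \<otimes> (c *\<^sub>C 1)" by (simp add: a tensor_scaleC_left tensor_scaleC_right)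
  thus "h \<in> scalars" using coinvariant_embedding_range_left by blast
next
  assume "h \<in> scalars"
  then obtain c where "h = c *\<^sub>C 1" by (auto simp: scalars_def)
  hence "coinvariant_embedding h = (c *\<^sub>C 1) \<otimes> 1"
    by (simp add: can_inject[symmetric] tensor_scaleC_left L.coaction_unit
        clinear_can(2)[unfolded clinear_iff])
  thus "coinvariant_embedding h \<in> range (\<lambda>a. a \<otimes> 1)" by blast
qed

text \<open>Evaluation commutes with the embedding, so the two range conditions on its values become
  the boundary conditions of the suspension.\<close>

lemma join_coinvariants:
  "right_coinvariants join_carrier (join_coaction \<delta>) = tensor_map id coinvariant_embedding ` unreduced_suspension"
proof -
  have "tensor_map id coinvariant_embedding g \<in> join_carrier \<longleftrightarrow> g \<in> unreduced_suspension" for g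
    by (simp add: join_carrier_iff unreduced_suspension_def eval_at_map clinear_coinvariant_embedding
        coinvariant_embedding_range_left coinvariant_embedding_range_right)
  thus ?thesis by (auto simp: right_coinvariants_def join_coinvariants_UNIV)
qed

lemma coinvariants_isomorphic:
  "algebra_isomorphic
      (right_coinvariants join_carrier (join_coaction \<delta>)) (join_mult \<gamma>) join_unit
      (unreduced_suspension :: (cont01 \<otimes> 'h) set) (tensor_mult (*) (*)) (1 \<otimes> 1)"
proof (rule algebra_isomorphicI[where \<Psi> = "tensor_map id coinvariant_embedding"])
  let ?\<Psi> = "tensor_map id coinvariant_embedding :: cont01 \<otimes> 'h \<Rightarrow> _"
  have hom: "?\<Psi> (tensor_mult (*) (*) x y) = join_mult \<gamma> (?\<Psi> x) (?\<Psi> y)" for x y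
    unfolding join_mult_def
    by (rule tensor_mult_map) (simp_all add: coinvariant_embedding_mult clinear_coinvariant_embedding cbilinear_times cbilinear_bmult clin)
  have one: "?\<Psi> (1 \<otimes> 1) = join_unit"
    by (simp add: clinear_coinvariant_embedding coinvariant_embedding_one join_unit_def clin)
  show lin: "clinear ?\<Psi>" by (rule clinear_tensor_map[OF clinear_ident(2) clinear_coinvariant_embedding clinear_ident(1)])
  show "inj ?\<Psi>" by (intro inj_tensor_map clinear_coinvariant_embedding inj_coinvariant_embedding inj_on_id clin)
  show "complex_algebra_on (unreduced_suspension :: (cont01 \<otimes> 'h) set) (tensor_mult (*) (*)) (1 \<otimes> 1)"
    by (rule unreduced_suspension_algebra)
  interpret J: right_comodule_algebra \<Delta> \<epsilon> join_carrier "join_mult \<gamma>" join_unit "join_coaction \<delta>"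
    by (rule join_comodule_algebra)
  show "complex_algebra_on (right_coinvariants join_carrier (join_coaction \<delta>)) (join_mult \<gamma>) join_unit"
  proof (rule complex_algebra_on_subset[OF join_algebra])
    \<comment> \<open>Written as an intersection with a linear image, the coinvariants are visibly a
      subspace.\<close>
    have "right_coinvariants join_carrier (join_coaction \<delta>) = join_carrier \<inter> range ?\<Psi>"
      by (auto simp: right_coinvariants_def join_coinvariants_UNIV)
    thus "cv.subspace (right_coinvariants join_carrier (join_coaction \<delta>))"
      using cv.subspace_inter[OF subspace_join_carrier subspace_range[OF lin]] by simp
    show "join_unit \<in> right_coinvariants join_carrier (join_coaction \<delta>)"
      by (simp add: right_coinvariants_def join_unit_in J.coaction_unit)
    show "join_mult \<gamma> x y \<in> right_coinvariants join_carrier (join_coaction \<delta>)"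
      if "x \<in> right_coinvariants join_carrier (join_coaction \<delta>)"
        "y \<in> right_coinvariants join_carrier (join_coaction \<delta>)" for x y
      using that join_algebra by (auto simp: right_coinvariants_def complex_algebra_on_def J.coaction_mult
          tensor_mult_tensor cbilinear_join_mult cbilinear_times)
  qed (simp add: right_coinvariants_def)
qed (simp_all add: join_coinvariants tensor_mult_map join_mult_def join_unit_def coinvariant_embedding_mult coinvariant_embedding_one
    clinear_coinvariant_embedding cbilinear_times cbilinear_bmult clin)

end

theorem theorem2p5:
  fixes \<Delta> :: "'h::complex_algebra_1 \<Rightarrow> 'h \<otimes> 'h"
    and \<epsilon> :: "'h \<Rightarrow> complex"
    and S :: "'h \<Rightarrow> 'h"
    and \<gamma> :: "'a::complex_algebra_1 \<Rightarrow> 'h \<otimes> 'a"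
    and \<delta> :: "'a \<Rightarrow> 'a \<otimes> 'h"
  assumes "hopf_algebra \<Delta> \<epsilon> S"
    and "bij S"
    and "bicomodule_algebra \<Delta> \<epsilon> \<gamma> \<delta>"
    and "left_galois_object \<gamma>"
    and "right_galois_object \<delta>"
  shows "principal_coaction \<Delta> \<epsilon> S join_carrier (join_mult \<gamma>) join_unit (join_coaction \<delta>) \<and>
    algebra_isomorphic
      (right_coinvariants join_carrier (join_coaction \<delta>)) (join_mult \<gamma>) join_unit
      (unreduced_suspension :: (cont01 \<otimes> 'h) set) (tensor_mult (*) (*)) (1 \<otimes> 1)"
proof -
  interpret bigalois \<Delta> \<epsilon> S \<gamma> \<delta>
    using assms by (rule bigalois.intro)
  show ?thesis
    using join_comodule_algebra strong_connection_connection coinvariants_isomorphic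
    by (auto simp: principal_coaction_def)
qed

end
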